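(* Let $\mathcal X\subset\mathbb R^d$ be nonempty and compact, let $\ell:\mathcal X\times\Xi\to\mathbb R$ be such that $\ell(\cdot;\xi)$ is continuous on $\mathcal X$, and let $\xi_1,\xi_2,\dots$ be i.i.d. with distribution $P_0$, with empirical distributions $\widehat P_n$. Let $f$ satisfy the smoothness assumption in the context and $\rho>0$. Assume there exist $Z:\Xi\to\mathbb R_+$ and $\epsilon>0$ with $|\ell(x;\xi)|\le Z(\xi)$ for all $x\in\mathcal X$ and $\mathbb E_{P_0}[Z(\xi)^{1+\epsilon}]<\infty$. Then $$\inf_{x\in\mathcal X}\sup_{P\ll\widehat P_n}\Big\{\mathbb E_P[\ell(x;\xi)]:D_f(P\|\widehat P_n)\le\tfrac\rho n\Big\}-\inf_{x\in\mathcal X}\mathbb E_{P_0}[\ell(x;\xi)]\to0$$ in outer probability, and $d_{\subset}(S^\star_{\widehat P_n},S^\star_{P_0})\to0$ in outer probability, where $$S^\star_{P_0}=\operatorname*{argmin}_{x\in\mathcal X}\mathbb E_{P_0}[\ell(x;\xi)],\qquad S^\star_{\widehat P_n}=\operatorname*{argmin}_{x\in\mathcal X}\sup_{P\ll\widehat P_n}\Big\{\mathbb E_P[\ell(x;\xi)]:D_f(P\|\widehat P_n)\le\tfrac\rho n\Big\}.$$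
   Context: $(\Xi,\mathcal A,P_0)$ is a probability space with $\Xi$ a subset of a separable metric space; $\ell(x;\cdot)$ is measurable for each $x$. Smoothness assumption on $f$: $f:[0,\infty)\to\mathbb R\cup\{+\infty\}$ is lower semicontinuous and convex, three times differentiable in a neighborhood of $1$, with $f(1)=f'(1)=0$ and $f''(1)=2$. For probability measures $P\ll Q$, $D_f(P\|Q)=\int f\!\left(\frac{dP}{dQ}\right)dQ$. For sets $A,B\subset\mathbb R^d$, $d_{\subset}(A,B)=\sup_{x\in A}\operatorname{dist}(x,B)$, where $\operatorname{dist}(x,B)=\inf_{y\in B}\|x-y\|$ for a norm $\|\cdot\|$. *)

theory Defs
  imports "HOL-Probability.Probability"
begin

definition lower_semicontinuous_on :: "real set \<Rightarrow> (real \<Rightarrow> ereal) \<Rightarrow> bool" where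
  "lower_semicontinuous_on S f \<longleftrightarrow> (\<forall>t\<in>S. f t \<le> Liminf (at t within S) f)"

text \<open>The weights are kept strictly positive so that \<open>0 * \<infinity>\<close> never occurs.\<close>

definition ereal_convex_on :: "real set \<Rightarrow> (real \<Rightarrow> ereal) \<Rightarrow> bool" where
  "ereal_convex_on S f \<longleftrightarrow>
     (\<forall>s\<in>S. \<forall>t\<in>S. \<forall>u>0. \<forall>v>0. u + v = 1 \<longrightarrow>
        f (u * s + v * t) \<le> ereal u * f s + ereal v * f t)"

text \<open>Only the restriction of \<open>f\<close> to \<open>[0,\<infinity>)\<close> matters.  The neighbourhood of \<open>1\<close> may be shrunk,
  so it can be taken inside \<open>[0,\<infinity>)\<close>; on it \<open>f\<close> is finite and the derivatives are those of its
  real-valued version.\<close>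

definition smooth_divergence_generator :: "(real \<Rightarrow> ereal) \<Rightarrow> bool" where
  "smooth_divergence_generator f \<longleftrightarrow>
     (\<forall>t\<ge>0. f t \<noteq> -\<infinity>) \<and>
     lower_semicontinuous_on {0..} f \<and>
     ereal_convex_on {0..} f \<and>
     (\<exists>\<delta>>0. \<forall>t\<in>ball 1 \<delta>. \<bar>f t\<bar> \<noteq> \<infinity> \<and>
        (\<forall>k<3. (deriv ^^ k) (\<lambda>s. real_of_ereal (f s)) field_differentiable at t)) \<and>
     f 1 = 0 \<and>
     deriv (\<lambda>s. real_of_ereal (f s)) 1 = 0 \<and>
     (deriv ^^ 2) (\<lambda>s. real_of_ereal (f s)) 1 = 2"

text \<open>Lebesgue integral of an extended-real function: positive part minus negative part.\<close>

definition ereal_integral :: "'b measure \<Rightarrow> ('b \<Rightarrow> ereal) \<Rightarrow> ereal" where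
  "ereal_integral Q h =
     enn2ereal (\<integral>\<^sup>+ \<xi>. e2ennreal (h \<xi>) \<partial>Q) - enn2ereal (\<integral>\<^sup>+ \<xi>. e2ennreal (- h \<xi>) \<partial>Q)"

text \<open>In the library \<open>RN_deriv Q P\<close> is \<open>dP/dQ\<close>, and \<open>absolutely_continuous Q P\<close> means \<open>P \<lless> Q\<close>.\<close>

definition f_divergence :: "(real \<Rightarrow> ereal) \<Rightarrow> 'b measure \<Rightarrow> 'b measure \<Rightarrow> ereal" where
  "f_divergence f P Q = ereal_integral Q (\<lambda>\<xi>. f (enn2real (RN_deriv Q P \<xi>)))"

definition divergence_ball :: "(real \<Rightarrow> ereal) \<Rightarrow> real \<Rightarrow> 'b measure \<Rightarrow> 'b measure set" where
  "divergence_ball f r Q =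
     {P. prob_space P \<and> sets P = sets Q \<and> absolutely_continuous Q P \<and> f_divergence f P Q \<le> ereal r}"

definition robust_risk ::
  "(real \<Rightarrow> ereal) \<Rightarrow> real \<Rightarrow> 'b measure \<Rightarrow> ('a \<Rightarrow> 'b \<Rightarrow> real) \<Rightarrow> 'a \<Rightarrow> ereal" where
  "robust_risk f r Q l x = (SUP P \<in> divergence_ball f r Q. ereal (\<integral>\<xi>. l x \<xi> \<partial>P))"

definition risk :: "'b measure \<Rightarrow> ('a \<Rightarrow> 'b \<Rightarrow> real) \<Rightarrow> 'a \<Rightarrow> ereal" where
  "risk P l x = ereal (\<integral>\<xi>. l x \<xi> \<partial>P)"

definition argmin_on :: "'a set \<Rightarrow> ('a \<Rightarrow> ereal) \<Rightarrow> 'a set" where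
  "argmin_on X h = {x. is_arg_min h (\<lambda>y. y \<in> X) x}"

text \<open>The empirical measure of \<open>x 1, \<dots>, x n\<close> on the measurable space \<open>S\<close>, as the law of \<open>x I\<close> for
  \<open>I\<close> uniform on \<open>{1..n}\<close>; see the lemma below for the usual formula.\<close>

definition empirical_measure :: "'b measure \<Rightarrow> nat \<Rightarrow> (nat \<Rightarrow> 'b) \<Rightarrow> 'b measure" where
  "empirical_measure S n x = distr (uniform_count_measure {1..n}) S x"

lemma emeasure_empirical_measure:
  assumes "n > 0" "\<And>i. i \<in> {1..n} \<Longrightarrow> x i \<in> space S" "A \<in> sets S"
  shows "emeasure (empirical_measure S n x) A = ennreal ((\<Sum>i=1..n. indicator A (x i)) / real n)"
proof -
  have "x \<in> measurable (uniform_count_measure {1..n}) S"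
    using assms(2) by (auto simp: measurable_def space_uniform_count_measure
        sets_uniform_count_measure)
  then have "emeasure (empirical_measure S n x) A
      = emeasure (uniform_count_measure {1..n}) (x -` A \<inter> {1..n})"
    using assms(3) by (simp add: empirical_measure_def emeasure_distr space_uniform_count_measure)
  also have "\<dots> = ennreal (real (card (x -` A \<inter> {1..n})) / real n)"
    by (subst emeasure_uniform_count_measure) auto
  also have "real (card (x -` A \<inter> {1..n})) = (\<Sum>i=1..n. indicator A (x i))"
    by (simp add: indicator_def sum.If_cases Int_def conj_commute)
  finally show ?thesis .
qed

definition is_norm :: "('a::real_vector \<Rightarrow> real) \<Rightarrow> bool" where
  "is_norm N \<longleftrightarrow>
     (\<forall>x. 0 \<le> N x) \<and> (\<forall>x. N x = 0 \<longleftrightarrow> x = 0) \<and>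
     (\<forall>c x. N (c *\<^sub>R x) = \<bar>c\<bar> * N x) \<and> (\<forall>x y. N (x + y) \<le> N x + N y)"

definition excess_dist :: "('a::real_vector \<Rightarrow> real) \<Rightarrow> 'a set \<Rightarrow> 'a set \<Rightarrow> ereal" where
  "excess_dist N A B = (SUP x\<in>A. INF y\<in>B. ereal (N (x - y)))"

definition tendsto_zero_outer_prob :: "'w measure \<Rightarrow> (nat \<Rightarrow> 'w \<Rightarrow> ereal) \<Rightarrow> bool" where
  "tendsto_zero_outer_prob M Y \<longleftrightarrow>
     (\<forall>e>0. (\<lambda>n. outer_measure_of M {\<omega> \<in> space M. \<bar>Y n \<omega>\<bar> > ereal e}) \<longlonglongrightarrow> 0)"

end

theory Submission
  imports Defs "HOL-Real_Asymp.Real_Asymp"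
begin

text \<open>
  Convexity together with \<open>f(1) = f'(1) = 0 < f''(1)\<close> gives, for each \<open>\<eta> > 0\<close>, some \<open>\<kappa> > 0\<close> with
  \<open>f(t) \<ge> \<kappa> max(0, |t - 1| - \<eta>)\<close>.  A measure \<open>P\<close> in the divergence ball around the empirical measure
  has weights \<open>w\<^sub>i / n\<close> with \<open>\<Sum> f(w\<^sub>i) \<le> \<rho>\<close>, so its expected loss differs from the empirical mean by at
  most the average of \<open>|w\<^sub>i - 1| Z(\<xi>\<^sub>i)\<close>, hence by at most
  \<open>\<eta> \<cdot> mean(Z) + max\<^sub>i Z(\<xi>\<^sub>i) \<cdot> \<rho> / (\<kappa> n)\<close>.  The moment of order \<open>1 + \<epsilon>\<close> forces
  \<open>max\<^sub>i Z(\<xi>\<^sub>i) / n \<rightarrow> 0\<close> in probability.  Hence the robust risk is uniformly close to the empirical risk,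
  which is uniformly close to the true risk by a weak law and finite bracketing over the compact \<open>X\<close>.
  Values and minimisers are then stable under uniform perturbations.  The set of robust minimisers has
  to be shown nonempty, because the excess of the empty set is \<open>-\<infinity>\<close>.
\<close>

subsection \<open>Growth of divergence generators\<close>

text \<open>Since f'(1) = 0 and f''(1) = 2, the derivative is negative just left of 1 and positive
  just right of it. The mean value theorem between 1 and t then gives strict positivity off
  1.\<close>

lemma divergence_generator_pos_near_1:
  assumes "smooth_divergence_generator f"
  obtains d where "0 < d" "d \<le> 1"
    "\<And>t. \<bar>t - 1\<bar> < d \<Longrightarrow> \<bar>f t\<bar> \<noteq> \<infinity>"
    "\<And>t. 0 < \<bar>t - 1\<bar> \<Longrightarrow> \<bar>t - 1\<bar> < d \<Longrightarrow> 0 < f t"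
proof -
  define F where "F = (\<lambda>s. real_of_ereal (f s))"
  have "\<exists>\<delta>>0. \<forall>t\<in>ball 1 \<delta>. \<bar>f t\<bar> \<noteq> \<infinity> \<and> (\<forall>k<3. (deriv ^^ k) F field_differentiable at t)"
    using assms unfolding smooth_divergence_generator_def F_def by (elim conjE)
  then obtain e where e: "e > 0" "\<And>t. t \<in> ball 1 e \<Longrightarrow> \<bar>f t\<bar> \<noteq> \<infinity>"
    "\<And>t k. t \<in> ball 1 e \<Longrightarrow> k < 3 \<Longrightarrow> (deriv ^^ k) F field_differentiable at t"
    by meson
  have F1: "F 1 = 0" "deriv F 1 = 0" "(deriv ^^ 2) F 1 = 2"
    using assms unfolding smooth_divergence_generator_def F_def by simp_all
  have dF: "(F has_real_derivative deriv F t) (at t)" if "t \<in> ball 1 e" for t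
    using e(3)[OF that, of 0] by (simp add: field_differentiable_derivI)
  have ddF: "(deriv F has_real_derivative 2) (at 1)"
    using e(3)[of 1 1] e(1) F1(3) field_differentiable_derivI[of "deriv F" 1]
    by (simp add: numeral_2_eq_2)
  obtain d1 where d1: "d1 > 0" "\<And>h. 0 < h \<Longrightarrow> h < d1 \<Longrightarrow> deriv F 1 < deriv F (1 + h)"
    using DERIV_pos_inc_right[OF ddF] by auto
  obtain d2 where d2: "d2 > 0" "\<And>h. 0 < h \<Longrightarrow> h < d2 \<Longrightarrow> deriv F (1 - h) < deriv F 1"
    using DERIV_pos_inc_left[OF ddF] by auto
  define d where "d = Min {1, e, d1, d2}"
  have d: "0 < d" "d \<le> 1" "d \<le> e" "d \<le> d1" "d \<le> d2"
    using e(1) d1(1) d2(1) by (auto simp: d_def)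
  have fin: "\<bar>f t\<bar> \<noteq> \<infinity>" if "\<bar>t - 1\<bar> < d" for t
    using e(2)[of t] d that by (simp add: dist_real_def)
  have "0 < F t" if t: "0 < \<bar>t - 1\<bar>" "\<bar>t - 1\<bar> < d" for t
  proof (cases "t > 1")
    case True
    have "\<exists>z. 1 < z \<and> z < t \<and> F t - F 1 = (t - 1) * deriv F z"
      using True t d by (intro MVT2 dF) (auto simp: dist_real_def)
    then obtain z where z: "1 < z" "z < t" "F t - F 1 = (t - 1) * deriv F z" by blast
    have "0 < deriv F z" using d1(2)[of "z - 1"] z t d F1 by auto
    then show ?thesis using z F1 True by simp
  next
    case False
    have "\<exists>z. t < z \<and> z < 1 \<and> F 1 - F t = (1 - t) * deriv F z"
      using False t d by (intro MVT2 dF) (auto simp: dist_real_def)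
    then obtain z where z: "t < z" "z < 1" "F 1 - F t = (1 - t) * deriv F z" by blast
    have "deriv F z < 0" using d2(2)[of "1 - z"] z t d F1 by auto
    then have "(1 - t) * deriv F z < 0" using z by (intro mult_pos_neg) auto
    then show ?thesis using z F1 by simp
  qed
  then have "0 < f t" if "0 < \<bar>t - 1\<bar>" "\<bar>t - 1\<bar> < d" for t
    using that fin[OF that(2)] unfolding F_def by (cases "f t") (fastforce)+
  with d fin show ?thesis using that by blast
qed

text \<open>Convexity along the segment from \<open>1\<close> to \<open>t\<close> propagates strict positivity at distance
  \<open>h\<close> from \<open>1\<close> to linear growth beyond it.\<close>

lemma divergence_generator_linear_growth:
  assumes f: "smooth_divergence_generator f" and h: "0 < h" "h \<le> \<bar>t - 1\<bar>" "0 \<le> t"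
    and c: "ereal c \<le> f (1 + h)" "ereal c \<le> f (1 - h)"
  shows "ereal (c * \<bar>t - 1\<bar> / h) \<le> f t"
proof -
  \<comment> \<open>With weight \<open>u\<close> on \<open>t\<close>, the convex combination of 1
    and \<open>t\<close> lies at distance exactly \<open>h\<close> from 1, on the same side as
    \<open>t\<close>.\<close>
  define u where "u = h / \<bar>t - 1\<bar>"
  have u: "0 < u" "u \<le> 1" using h by (auto simp: u_def)
  have f1: "f 1 = 0" and conv: "ereal_convex_on {0..} f"
    using f unfolding smooth_divergence_generator_def by auto
  have eq: "(1 - u) * 1 + u * t = (if t > 1 then 1 + h else 1 - h)"
    using h by (auto simp: u_def field_simps)
  have "ereal c \<le> f ((1 - u) * 1 + u * t)" using c eq by simp
  also have "\<dots> \<le> ereal u * f t"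
  \<comment> \<open>\<open>ereal_convex_on\<close> speaks of strictly positive weights, so the
    endpoint \<open>u = 1\<close> is treated apart.\<close>
  proof (cases "u = 1")
    case True then show ?thesis by (simp flip: one_ereal_def)
  next
    case False
    then have "f ((1 - u) * 1 + u * t) \<le> ereal (1 - u) * f 1 + ereal u * f t"
      using conv[unfolded ereal_convex_on_def, THEN bspec[of _ _ 1], THEN bspec[of _ _ t],
          THEN spec[of _ "1 - u"], THEN mp, THEN spec[of _ u]] u h(3) by simp
    then show ?thesis by (simp add: f1)
  qed
  finally have "ereal c \<le> ereal u * f t" .
  then have "ereal (c / u) \<le> f t"
    using u by (cases "f t") (auto simp: field_simps)
  then show ?thesis by (simp add: u_def)
qed

text \<open>Near 1 the generator behaves like (t - 1)^2, so no linear bound in |t - 1| holds up to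
  1. Cutting out a zone of radius \<open>\<eta>\<close> leaves a region where convexity forces
  linear growth, and inside the zone nonnegativity of \<open>f\<close> is enough.\<close>

lemma divergence_generator_minorant:
  assumes f: "smooth_divergence_generator f" and "\<eta> > 0"
  obtains \<kappa> where "\<kappa> > 0" "\<And>t. 0 \<le> t \<Longrightarrow> ereal (\<kappa> * max 0 (\<bar>t - 1\<bar> - \<eta>)) \<le> f t"
proof -
  obtain d where d: "0 < d" "d \<le> 1" "\<And>t. \<bar>t - 1\<bar> < d \<Longrightarrow> \<bar>f t\<bar> \<noteq> \<infinity>"
    "\<And>t. 0 < \<bar>t - 1\<bar> \<Longrightarrow> \<bar>t - 1\<bar> < d \<Longrightarrow> 0 < f t"
    using divergence_generator_pos_near_1[OF f] by metis
  have f1: "f 1 = 0" using f unfolding smooth_divergence_generator_def by auto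
  have nonneg: "0 \<le> f t" if "0 \<le> t" for t
  proof (cases "\<bar>t - 1\<bar> < d")
    case True then show ?thesis using d(4)[of t] f1 by (cases "t = 1") auto
  next
    case False
    then show ?thesis
      using divergence_generator_linear_growth[OF f, of "d / 2" t 0] that d
      by (simp add: zero_ereal_def[symmetric] less_imp_le)
  qed
  \<comment> \<open>\<open>h \<le> \<eta>\<close> places every point outside the zone at distance at
    least \<open>h\<close> from 1. \<open>h < d\<close> makes both values \<open>f (1 + h)\<close>
    and \<open>f (1 - h)\<close> finite and positive, so their minimum \<open>c\<close> is a
    positive real.\<close>
  define h where "h = min \<eta> (d / 2)"
  have h: "0 < h" "h < d" "h \<le> \<eta>" using d assms by (auto simp: h_def)
  have pos: "0 < f (1 + h)" "0 < f (1 - h)" "\<bar>f (1 + h)\<bar> \<noteq> \<infinity>" "\<bar>f (1 - h)\<bar> \<noteq> \<infinity>"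
    using d(3,4)[of "1 + h"] d(3,4)[of "1 - h"] h by auto
  define c where "c = min (real_of_ereal (f (1 + h))) (real_of_ereal (f (1 - h)))"
  have c: "0 < c" "ereal c \<le> f (1 + h)" "ereal c \<le> f (1 - h)"
    using pos unfolding c_def by (cases "f (1 + h)"; cases "f (1 - h)"; force)+
  show ?thesis
  proof
    show "c / h > 0" using c h by simp
    fix t :: real assume t: "0 \<le> t"
    show "ereal (c / h * max 0 (\<bar>t - 1\<bar> - \<eta>)) \<le> f t"
    proof (cases "\<bar>t - 1\<bar> \<le> \<eta>")
      case True then show ?thesis using nonneg[OF t] by (simp add: zero_ereal_def[symmetric])
    next
      case False
      have "c / h * max 0 (\<bar>t - 1\<bar> - \<eta>) \<le> c * \<bar>t - 1\<bar> / h"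
        using c h False assms by (simp add: divide_right_mono)
      then have "ereal (c / h * max 0 (\<bar>t - 1\<bar> - \<eta>)) \<le> ereal (c * \<bar>t - 1\<bar> / h)" by simp
      also have "\<dots> \<le> f t"
        using False h t c by (intro divergence_generator_linear_growth[OF f]) auto
      finally show ?thesis .
    qed
  qed
qed

subsection \<open>Divergence balls around empirical measures\<close>

lemma
  fixes x :: "nat \<Rightarrow> 'b" and n :: nat
  assumes n: "n > 0" and x: "\<And>i. i \<in> {1..n} \<Longrightarrow> x i \<in> space S"
  shows prob_space_empirical_measure: "prob_space (empirical_measure S n x)"
    and integrable_empirical_measure:
      "\<And>g::'b \<Rightarrow> real. g \<in> borel_measurable S \<Longrightarrow> integrable (empirical_measure S n x) g"
    and integral_empirical_measure:
      "\<And>g::'b \<Rightarrow> real. g \<in> borel_measurable S \<Longrightarrow>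
        (\<integral>s. g s \<partial>empirical_measure S n x) = (\<Sum>i=1..n. g (x i)) / n"
proof -
  have m: "x \<in> measurable (uniform_count_measure {1..n}) S"
    using x by (auto simp: measurable_def space_uniform_count_measure sets_uniform_count_measure)
  show "prob_space (empirical_measure S n x)"
    unfolding empirical_measure_def using n m
    by (intro prob_space.prob_space_distr prob_space_uniform_count_measure) auto
  fix g :: "'b \<Rightarrow> real" assume g: "g \<in> borel_measurable S"
  show "integrable (empirical_measure S n x) g"
    unfolding empirical_measure_def using g m
    by (subst integrable_distr_eq) (auto simp: uniform_count_measure_def integrable_point_measure_finite)
  show "(\<integral>s. g s \<partial>empirical_measure S n x) = (\<Sum>i=1..n. g (x i)) / n"
    unfolding empirical_measure_def using g m
    by (subst integral_distr) (auto simp: integral_uniform_count_measure)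
qed

text \<open>The weights are the values of the density dP/dQ at the sample points, Q being the
  empirical measure; integrals against Q are finite sums. The real measurable minorant
  \<open>\<phi>\<close> stands in for \<open>f\<close>: its integral is such a sum, and monotonicity
  of the nonnegative integral compares it with the divergence without asking whether
  \<open>f\<close> composed with the density is measurable.\<close>

lemma divergence_ball_weights:
  fixes x :: "nat \<Rightarrow> 'b" and n :: nat and r :: real and \<phi> :: "real \<Rightarrow> real"
  assumes n: "n > 0" and x: "\<And>i. i \<in> {1..n} \<Longrightarrow> x i \<in> space S"
    and P: "P \<in> divergence_ball f r (empirical_measure S n x)"
    and minor: "\<And>t. 0 \<le> t \<Longrightarrow> ereal (\<phi> t) \<le> f t"
    and \<phi>: "\<And>t. 0 \<le> \<phi> t" "\<phi> \<in> borel_measurable borel"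
  obtains w where "\<And>i. 0 \<le> w i" "(\<Sum>i=1..n. \<phi> (w i)) \<le> n * r"
    "\<And>g::'b \<Rightarrow> real. g \<in> borel_measurable S \<Longrightarrow> (\<integral>s. g s \<partial>P) = (\<Sum>i=1..n. w i * g (x i)) / n"
proof -
  define Q where "Q = empirical_measure S n x"
  interpret Q: prob_space Q unfolding Q_def by (rule prob_space_empirical_measure[OF n x])
  have sQ: "sets Q = sets S" by (simp add: Q_def empirical_measure_def)
  have P: "prob_space P" "sets P = sets Q" "absolutely_continuous Q P" "f_divergence f P Q \<le> ereal r"
    using P by (auto simp: divergence_ball_def Q_def)
  interpret P: prob_space P by (rule P(1))
  define D where "D = (\<lambda>s. enn2real (RN_deriv Q P s))"
  have mQ: "borel_measurable S = borel_measurable Q"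
    using sQ by (intro measurable_cong_sets) auto
  have D: "D \<in> borel_measurable S" "\<And>s. 0 \<le> D s"
    unfolding D_def mQ by simp_all
  have f0: "0 \<le> f t" if "0 \<le> t" for t
    using minor[OF that] \<phi>(1)[of t] by (meson ereal_less_eq(5) order_trans)
  \<comment> \<open>\<open>\<phi> \<ge> 0\<close> forces \<open>f \<ge> 0\<close> on the range of
    the density, so the divergence reduces to its positive part.\<close>
  have neg: "(\<integral>\<^sup>+ s. e2ennreal (- f (D s)) \<partial>Q) = 0"
  proof -
    have "e2ennreal (- f (D s)) = 0" for s
      using f0[OF D(2)[of s]] by (intro e2ennreal_neg) (simp add: ereal_uminus_le_reorder)
    then show ?thesis by simp
  qed
  have m\<phi>: "(\<lambda>s. \<phi> (D s)) \<in> borel_measurable S"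
    using D(1) \<phi>(2) by measurable
  have "ennreal ((\<Sum>i=1..n. \<phi> (D (x i))) / n) = ennreal (\<integral>s. \<phi> (D s) \<partial>Q)"
    unfolding Q_def by (subst integral_empirical_measure[OF n x m\<phi>]) auto
  also have "\<dots> = (\<integral>\<^sup>+ s. ennreal (\<phi> (D s)) \<partial>Q)"
    unfolding Q_def using \<phi>(1)
    by (intro nn_integral_eq_integral[symmetric] integrable_empirical_measure[OF n x m\<phi>]) auto
  also have "\<dots> \<le> (\<integral>\<^sup>+ s. e2ennreal (f (D s)) \<partial>Q)"
    using e2ennreal_mono[OF minor[OF D(2)]] by (intro nn_integral_mono) (simp add: e2ennreal_ereal)
  finally have "enn2ereal (ennreal ((\<Sum>i=1..n. \<phi> (D (x i))) / n)) \<le> f_divergence f P Q"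
    using neg unfolding f_divergence_def ereal_integral_def D_def
    by (simp add: zero_ennreal.rep_eq less_eq_ennreal.rep_eq)
  also note P(4)
  finally have "ereal ((\<Sum>i=1..n. \<phi> (D (x i))) / n) \<le> ereal r"
    using \<phi>(1) by (subst (asm) enn2ereal_ennreal) (auto intro!: divide_nonneg_nonneg sum_nonneg)
  then have le: "(\<Sum>i=1..n. \<phi> (D (x i))) \<le> n * r"
    using n by (simp add: field_simps)
  have "(\<integral>s. g s \<partial>P) = (\<Sum>i=1..n. D (x i) * g (x i)) / n"
    if g: "g \<in> borel_measurable S" for g :: "'b \<Rightarrow> real"
  proof -
    have "(\<integral>s. g s \<partial>P) = (\<integral>s. D s * g s \<partial>Q)"
      unfolding D_def using g P(2,3)
      by (intro Q.RN_deriv_integral P.sigma_finite_measure_axioms) (simp_all add: mQ)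
    also have "\<dots> = (\<Sum>i=1..n. D (x i) * g (x i)) / n"
      unfolding Q_def by (intro integral_empirical_measure[OF n x] borel_measurable_times g D)
    finally show ?thesis .
  qed
  with that[of "\<lambda>i. D (x i)"] D le show ?thesis by blast
qed

text \<open>Put \<open>v i = max 0 (\<bar>w i - 1\<bar> - \<eta>)\<close>. The divergence budget
  bounds the sum of the \<open>v i\<close> by \<open>\<rho> / \<kappa>\<close>, independently of
  \<open>n\<close>. Since \<open>\<bar>w i - 1\<bar> \<le> \<eta> + v i\<close>, the
  \<open>\<eta>\<close> share of the error is charged to the mean of \<open>z\<close> and the
  \<open>v\<close> share to the uniform bound \<open>b\<close>.\<close>

lemma divergence_ball_deviation:
  fixes x :: "nat \<Rightarrow> 'b" and n :: nat and \<rho> \<kappa> \<eta> b :: real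
  assumes n: "n > 0" and x: "\<And>i. i \<in> {1..n} \<Longrightarrow> x i \<in> space S"
    and P: "P \<in> divergence_ball f (\<rho> / n) (empirical_measure S n x)"
    and \<kappa>: "\<kappa> > 0" "\<And>t. 0 \<le> t \<Longrightarrow> ereal (\<kappa> * max 0 (\<bar>t - 1\<bar> - \<eta>)) \<le> f t"
    and g: "g \<in> borel_measurable S" "\<And>i. i \<in> {1..n} \<Longrightarrow> \<bar>g (x i)\<bar> \<le> z i"
    and b: "\<And>i. i \<in> {1..n} \<Longrightarrow> z i \<le> b" "0 \<le> b"
  shows "\<bar>(\<integral>s. g s \<partial>P) - (\<Sum>i=1..n. g (x i)) / n\<bar> \<le> \<eta> * ((\<Sum>i=1..n. z i) / n) + b * \<rho> / (\<kappa> * n)"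
proof -
  obtain w where w: "\<And>i. 0 \<le> w i" "(\<Sum>i=1..n. \<kappa> * max 0 (\<bar>w i - 1\<bar> - \<eta>)) \<le> n * (\<rho> / n)"
    "(\<integral>s. g s \<partial>P) = (\<Sum>i=1..n. w i * g (x i)) / n"
    by (rule divergence_ball_weights[where \<phi> = "\<lambda>t. \<kappa> * max 0 (\<bar>t - 1\<bar> - \<eta>)", OF n x P \<kappa>(2)])
      (use \<kappa>(1) g(1) in auto)
  define v where "v = (\<lambda>i. max 0 (\<bar>w i - 1\<bar> - \<eta>))"
  have "(\<Sum>i=1..n. v i) \<le> \<rho> / \<kappa>"
    using w(2) n \<kappa>(1) by (simp add: v_def field_simps flip: sum_distrib_left)
  then have v: "b * (\<Sum>i=1..n. v i) \<le> b * (\<rho> / \<kappa>)" using b(2) by (intro mult_left_mono)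
  have "\<bar>(\<integral>s. g s \<partial>P) - (\<Sum>i=1..n. g (x i)) / n\<bar> = \<bar>\<Sum>i=1..n. (w i - 1) * g (x i)\<bar> / n"
    by (simp add: w(3) algebra_simps sum_subtractf flip: diff_divide_distrib)
  also have "\<bar>\<Sum>i=1..n. (w i - 1) * g (x i)\<bar> \<le> (\<Sum>i=1..n. \<eta> * z i + b * v i)"
  proof (intro order_trans[OF sum_abs] sum_mono)
    fix i assume i: "i \<in> {1..n}"
    have z: "0 \<le> z i" using g(2)[OF i] by linarith
    have "\<bar>(w i - 1) * g (x i)\<bar> \<le> \<bar>w i - 1\<bar> * z i"
      using g(2)[OF i] by (simp add: abs_mult mult_left_mono)
    also have "\<dots> \<le> (\<eta> + v i) * z i" using z by (intro mult_right_mono) (auto simp: v_def)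
    also have "\<dots> \<le> \<eta> * z i + b * v i"
      using mult_right_mono[OF b(1)[OF i], of "v i"] by (simp add: v_def algebra_simps)
    finally show "\<bar>(w i - 1) * g (x i)\<bar> \<le> \<eta> * z i + b * v i" .
  qed
  also have "\<dots> = \<eta> * (\<Sum>i=1..n. z i) + b * (\<Sum>i=1..n. v i)"
    by (simp add: sum.distrib sum_distrib_left)
  also have "\<dots> \<le> \<eta> * (\<Sum>i=1..n. z i) + b * (\<rho> / \<kappa>)" using v by simp
  finally show ?thesis
    using n by (simp add: divide_right_mono add_divide_distrib)
qed

text \<open>The density of a probability measure with respect to itself is 1 almost everywhere, so
  both parts of the divergence integral vanish by \<open>f 1 = 0\<close>.\<close>

lemma empirical_measure_in_divergence_ball:
  fixes x :: "nat \<Rightarrow> 'b" and n :: nat and r :: real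
  assumes n: "n > 0" and x: "\<And>i. i \<in> {1..n} \<Longrightarrow> x i \<in> space S" and "f 1 = 0" "0 \<le> r"
  shows "empirical_measure S n x \<in> divergence_ball f r (empirical_measure S n x)"
proof -
  define Q where "Q = empirical_measure S n x"
  interpret Q: prob_space Q unfolding Q_def by (rule prob_space_empirical_measure[OF n x])
  have "AE s in Q. 1 = RN_deriv Q Q s"
    by (intro Q.RN_deriv_unique) (auto simp: density_1)
  then have AE: "AE s in Q. f (enn2real (RN_deriv Q Q s)) = 0"
    by eventually_elim (metis enn2real_1 assms(3))
  then have "(\<integral>\<^sup>+ s. e2ennreal (f (enn2real (RN_deriv Q Q s))) \<partial>Q) = (\<integral>\<^sup>+ s. 0 \<partial>Q)"
    by (intro nn_integral_cong_AE) (auto simp: e2ennreal_neg)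
  moreover from AE have "(\<integral>\<^sup>+ s. e2ennreal (- f (enn2real (RN_deriv Q Q s))) \<partial>Q) = (\<integral>\<^sup>+ s. 0 \<partial>Q)"
    by (intro nn_integral_cong_AE) (auto simp: e2ennreal_neg)
  ultimately have "f_divergence f Q Q = 0"
    by (simp add: f_divergence_def ereal_integral_def)
  then show ?thesis
    using assms(4) by (simp add: divergence_ball_def Q.prob_space_axioms absolutely_continuousI_density
      Q_def[symmetric] absolutely_continuous_def)
qed

text \<open>The two bounds are asymmetric: the empirical measure itself competes in the supremum,
  which gives the lower bound without error, while the upper bound applies the deviation estimate to
  every competitor.\<close>

lemma robust_risk_near_empirical:
  fixes x :: "nat \<Rightarrow> 'b" and n :: nat and \<rho> \<kappa> \<eta> b :: real
  assumes n: "n > 0" and x: "\<And>i. i \<in> {1..n} \<Longrightarrow> x i \<in> space S" and f: "f 1 = 0" "0 \<le> \<rho>"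
    and \<kappa>: "\<kappa> > 0" "\<And>t. 0 \<le> t \<Longrightarrow> ereal (\<kappa> * max 0 (\<bar>t - 1\<bar> - \<eta>)) \<le> f t"
    and g: "l y \<in> borel_measurable S" "\<And>i. i \<in> {1..n} \<Longrightarrow> \<bar>l y (x i)\<bar> \<le> z i"
    and b: "\<And>i. i \<in> {1..n} \<Longrightarrow> z i \<le> b" "0 \<le> b"
  shows "ereal ((\<Sum>i=1..n. l y (x i)) / n) \<le> robust_risk f (\<rho> / n) (empirical_measure S n x) l y"
    and "robust_risk f (\<rho> / n) (empirical_measure S n x) l y \<le>
      ereal ((\<Sum>i=1..n. l y (x i)) / n + \<eta> * ((\<Sum>i=1..n. z i) / n) + b * \<rho> / (\<kappa> * n))"
proof -
  have "empirical_measure S n x \<in> divergence_ball f (\<rho> / n) (empirical_measure S n x)"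
    using f by (intro empirical_measure_in_divergence_ball[OF n x]) auto
  from SUP_upper[OF this, of "\<lambda>P. ereal (\<integral>s. l y s \<partial>P)"]
  show "ereal ((\<Sum>i=1..n. l y (x i)) / n) \<le> robust_risk f (\<rho> / n) (empirical_measure S n x) l y"
    by (simp only: robust_risk_def integral_empirical_measure[OF n x g(1)])
  show "robust_risk f (\<rho> / n) (empirical_measure S n x) l y \<le>
      ereal ((\<Sum>i=1..n. l y (x i)) / n + \<eta> * ((\<Sum>i=1..n. z i) / n) + b * \<rho> / (\<kappa> * n))"
    unfolding robust_risk_def
  proof (rule SUP_least)
    fix P assume P: "P \<in> divergence_ball f (\<rho> / n) (empirical_measure S n x)"
    show "ereal (\<integral>s. l y s \<partial>P) \<le> 
      ereal ((\<Sum>i=1..n. l y (x i)) / n + \<eta> * ((\<Sum>i=1..n. z i) / n) + b * \<rho> / (\<kappa> * n))"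
      using divergence_ball_deviation[where g = "l y" and z = z and b = b, OF n x P \<kappa> g b] by simp
  qed
qed

subsection \<open>Existence and stability of minimisers\<close>

text \<open>The direct method: a supremum of continuous functions is lower semicontinuous, so the
  limit of a convergent minimising subsequence is a minimiser. Working in \<open>ereal\<close> also
  covers infinite suprema.\<close>

lemma argmin_SUP_continuous_nonempty:
  fixes c :: "'p \<Rightarrow> 'a::metric_space \<Rightarrow> real"
  assumes "compact X" "X \<noteq> {}" "\<And>P. P \<in> B \<Longrightarrow> continuous_on X (c P)"
  shows "argmin_on X (\<lambda>x. SUP P\<in>B. ereal (c P x)) \<noteq> {}"
proof -
  define h where "h = (\<lambda>x. SUP P\<in>B. ereal (c P x))"
  obtain u where u: "\<And>n. u n \<in> h ` X" "u \<longlonglongrightarrow> Inf (h ` X)"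
    using Inf_as_limit[of "h ` X"] assms(2) by auto
  then obtain y where y: "\<And>n. y n \<in> X" "\<And>n. u n = h (y n)"
    by (auto simp: image_iff) metis
  obtain a r where a: "a \<in> X" "strict_mono r" "(y \<circ> r) \<longlonglongrightarrow> a"
    using assms(1) y(1) unfolding compact_def by meson
  have "h a \<le> Inf (h ` X)"
    unfolding h_def
  proof (rule SUP_least)
    fix P assume P: "P \<in> B"
    have "(\<lambda>n. c P ((y \<circ> r) n)) \<longlonglongrightarrow> c P a"
      using a y(1) by (intro continuous_on_tendsto_compose[OF assms(3)[OF P] a(3)]) auto
    then have "(\<lambda>n. ereal (c P ((y \<circ> r) n))) \<longlonglongrightarrow> ereal (c P a)" by simp
    moreover have "(u \<circ> r) \<longlonglongrightarrow> Inf (h ` X)" using u(2) a(2) by (rule LIMSEQ_subseq_LIMSEQ)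
    moreover have "ereal (c P ((y \<circ> r) n)) \<le> (u \<circ> r) n" for n
      using P by (auto simp: y(2) h_def intro: SUP_upper)
    ultimately show "ereal (c P a) \<le> (INF x\<in>X. SUP P\<in>B. ereal (c P x))"
      using LIMSEQ_le[of _ "ereal (c P a)" "u \<circ> r" "Inf (h ` X)"] by (auto simp: h_def)
  qed
  then have "a \<in> argmin_on X h"
    using a(1) by (auto simp: argmin_on_def is_arg_min_def not_less intro: order_trans[OF _ INF_lower])
  then show ?thesis by (auto simp: h_def)
qed

text \<open>Under each measure in the ball the expected loss is a fixed weighted sum of finitely
  many continuous functions of the decision, hence continuous. The minorant 0 is enough to extract
  the weights.\<close>

lemma argmin_robust_risk_empirical_nonempty:
  fixes x :: "nat \<Rightarrow> 'b" and n :: nat and X :: "'a::metric_space set" and r :: real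
  assumes n: "n > 0" and x: "\<And>i. i \<in> {1..n} \<Longrightarrow> x i \<in> space S"
    and nonneg: "\<And>t. 0 \<le> t \<Longrightarrow> 0 \<le> f t"
    and X: "compact X" "X \<noteq> {}"
    and l: "\<And>y. y \<in> X \<Longrightarrow> l y \<in> borel_measurable S"
      "\<And>s. s \<in> space S \<Longrightarrow> continuous_on X (\<lambda>y. l y s)"
  shows "argmin_on X (robust_risk f r (empirical_measure S n x) l) \<noteq> {}"
proof -
  have "continuous_on X (\<lambda>y. \<integral>s. l y s \<partial>P)"
    if P: "P \<in> divergence_ball f r (empirical_measure S n x)" for P
  proof -
    obtain w where w: "\<And>g::'b \<Rightarrow> real. g \<in> borel_measurable S \<Longrightarrow>
        (\<integral>s. g s \<partial>P) = (\<Sum>i=1..n. w i * g (x i)) / n"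
      by (rule divergence_ball_weights[where \<phi> = "\<lambda>_. 0", OF n x P])
        (use nonneg in \<open>auto simp flip: zero_ereal_def\<close>)
    have "continuous_on X (\<lambda>y. (\<Sum>i=1..n. w i * l y (x i)) / n)"
      using n by (intro continuous_intros l(2) x) auto
    then show ?thesis by (rule continuous_on_eq) (simp add: w l(1))
  qed
  from argmin_SUP_continuous_nonempty[OF X, of "divergence_ball f r (empirical_measure S n x)", OF this]
  show ?thesis unfolding robust_risk_def .
qed

text \<open>Removing the open \<open>d\<close>-neighbourhood of the argmin leaves a compact set
  \<open>K\<close>. There \<open>R\<close> attains a minimum strictly above the global one, and this
  gap keeps near-minimisers out of \<open>K\<close>.\<close>

lemma argmin_stability:
  fixes R :: "'a::metric_space \<Rightarrow> real"
  assumes X: "compact X" "X \<noteq> {}" and R: "continuous_on X R" and "d > 0"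
  obtains a where "a > 0"
    "\<And>x. x \<in> X \<Longrightarrow> (\<And>y. y \<in> X \<Longrightarrow> R x \<le> R y + a) \<Longrightarrow>
      \<exists>y. y \<in> argmin_on X (\<lambda>x. ereal (R x)) \<and> dist x y < d"
proof -
  define A where "A = argmin_on X (\<lambda>x. ereal (R x))"
  have A: "x \<in> A \<longleftrightarrow> x \<in> X \<and> (\<forall>y\<in>X. R x \<le> R y)" for x
    by (auto simp: A_def argmin_on_def is_arg_min_def not_less)
  obtain m where m: "m \<in> X" "\<And>y. y \<in> X \<Longrightarrow> R m \<le> R y"
    using continuous_attains_inf[OF X R] by blast
  define K where "K = X - (\<Union>y\<in>A. ball y d)"
  have K: "compact K" unfolding K_def by (intro compact_diff X) auto
  show ?thesis
  proof (cases "K = {}")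
    case True
    then show ?thesis using that[of 1] unfolding K_def A_def[symmetric] by (force simp: dist_commute)
  next
    case False
    have "continuous_on K R" using R by (rule continuous_on_subset) (auto simp: K_def)
    then obtain k where k: "k \<in> K" "\<And>y. y \<in> K \<Longrightarrow> R k \<le> R y"
      using continuous_attains_inf[OF K False] by blast
    have "k \<notin> A" using k(1) \<open>d > 0\<close> by (auto simp: K_def)
    then obtain y where "y \<in> X" "R y < R k" using A[of k] k(1) by (auto simp: K_def not_le)
    then have "R m < R k" using m(2) by force
    show ?thesis
    proof
      \<comment> \<open>Half the gap is taken because near-minimality is a weak inequality: the full
        gap would not exclude points of \<open>K\<close>.\<close>
      show "(R k - R m) / 2 > 0" using \<open>R m < R k\<close> by simp
      fix x assume x: "x \<in> X" "\<And>y. y \<in> X \<Longrightarrow> R x \<le> R y + (R k - R m) / 2"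
      have "x \<notin> K"
      proof
        assume "x \<in> K"
        from k(2)[OF this] x(2)[OF m(1)] \<open>R m < R k\<close> show False by (simp add: field_simps)
      qed
      then show "\<exists>y. y \<in> argmin_on X (\<lambda>x. ereal (R x)) \<and> dist x y < d"
        using x(1) unfolding K_def A_def[symmetric] by (force simp: dist_commute)
    qed
  qed
qed

subsection \<open>Laws of large numbers for independent samples\<close>

text \<open>Dominated convergence: at each point the truncation is eventually exact, and the error
  never exceeds \<open>\<bar>g s\<bar>\<close>.\<close>

lemma integral_truncation_error:
  fixes g :: "'b \<Rightarrow> real"
  assumes "integrable S g"
  shows "(\<lambda>k. \<integral>s. \<bar>g s - max (- real k) (min (real k) (g s))\<bar> \<partial>S) \<longlonglongrightarrow> 0"
proof -
  have "(\<lambda>k. \<integral>s. \<bar>g s - max (- real k) (min (real k) (g s))\<bar> \<partial>S) \<longlonglongrightarrow> (\<integral>s. 0 \<partial>S)"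
  proof (rule integral_dominated_convergence[where w = "\<lambda>s. \<bar>g s\<bar>"])
    show "AE s in S. (\<lambda>k. \<bar>g s - max (- real k) (min (real k) (g s))\<bar>) \<longlonglongrightarrow> 0"
    proof (intro AE_I2 tendsto_eventually)
      fix s
      obtain k0 :: nat where "\<bar>g s\<bar> \<le> k0" using real_arch_simple by blast
      then show "\<forall>\<^sub>F k in sequentially. \<bar>g s - max (- real k) (min (real k) (g s))\<bar> = 0"
        by (intro eventually_sequentiallyI[of k0]) (auto simp: max_def min_def)
    qed
  qed (use assms in \<open>auto simp: max_def min_def\<close>)
  then show ?thesis by simp
qed

locale iid_sample = prob_space M + S: prob_space S
  for M :: "'w measure" and S :: "'b measure" +
  fixes \<xi> :: "nat \<Rightarrow> 'w \<Rightarrow> 'b"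
  assumes indep: "indep_vars (\<lambda>_. S) \<xi> {1..}"
    and distr_sample: "\<And>i. i \<ge> 1 \<Longrightarrow> distr M S (\<xi> i) = S"
begin

lemma measurable_sample: "i \<ge> 1 \<Longrightarrow> \<xi> i \<in> measurable M S"
  using indep by (auto simp: indep_vars_def)

lemma sample_in_space: "i \<ge> 1 \<Longrightarrow> \<omega> \<in> space M \<Longrightarrow> \<xi> i \<omega> \<in> space S"
  by (rule measurable_space[OF measurable_sample])

lemma
  fixes g :: "'b \<Rightarrow> real"
  assumes "integrable S g" "i \<ge> 1"
  shows integrable_sample: "integrable M (\<lambda>\<omega>. g (\<xi> i \<omega>))"
    and expectation_sample: "expectation (\<lambda>\<omega>. g (\<xi> i \<omega>)) = (\<integral>s. g s \<partial>S)"
  using integrable_distr[OF measurable_sample[OF assms(2)], of g]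
    integral_distr[OF measurable_sample[OF assms(2)], of g] assms
  by (auto simp: distr_sample)

lemma measurable_sample_mean:
  fixes g :: "'b \<Rightarrow> real"
  assumes "g \<in> borel_measurable S"
  shows "(\<lambda>\<omega>. (\<Sum>i=1..n. g (\<xi> i \<omega>)) / n) \<in> borel_measurable M"
  by (intro borel_measurable_divide borel_measurable_sum measurable_compose[OF measurable_sample assms])
    auto

text \<open>Hoeffding's inequality gives an exponentially small bound.\<close>

lemma weak_law_bounded:
  fixes g :: "'b \<Rightarrow> real"
  assumes g: "g \<in> borel_measurable S" "\<And>s. \<bar>g s\<bar> \<le> K" and "\<tau> > 0"
  shows "(\<lambda>n. prob {\<omega> \<in> space M. \<bar>(\<Sum>i=1..n. g (\<xi> i \<omega>)) / n - (\<integral>s. g s \<partial>S)\<bar> \<ge> \<tau>}) \<longlonglongrightarrow> 0"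
proof -
  \<comment> \<open>Enlarging the bound makes the interval from \<open>-K'\<close> to
    \<open>K'\<close> nondegenerate, as Hoeffding's inequality requires; its length
    \<open>2 * K'\<close> enters the rate \<open>c\<close>.\<close>
  define K' where "K' = \<bar>K\<bar> + 1"
  have K': "\<bar>g s\<bar> \<le> K'" "K' > 0" for s using g(2)[of s] by (auto simp: K'_def)
  have int: "integrable S g" using g by (intro S.integrable_const_bound[of _ K]) auto
  define c where "c = 2 * \<tau>\<^sup>2 / (2 * K')\<^sup>2"
  have le: "prob {\<omega> \<in> space M. \<bar>(\<Sum>i=1..n. g (\<xi> i \<omega>)) / n - (\<integral>s. g s \<partial>S)\<bar> \<ge> \<tau>}
      \<le> 2 * exp (- c * real n)" if n: "n > 0" for n
  proof -
    interpret H: Hoeffding_ineq_iid M "{1..n}" "\<lambda>i \<omega>. g (\<xi> i \<omega>)" "\<lambda>\<omega>. g (\<xi> 1 \<omega>)" "-K'" K'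
      "expectation (\<lambda>\<omega>. g (\<xi> 1 \<omega>))"
    proof unfold_locales
      show "indep_vars (\<lambda>_. borel) (\<lambda>i \<omega>. g (\<xi> i \<omega>)) {1..n}"
        by (rule indep_vars_compose2[OF indep_vars_subset[OF indep]]) (use g in auto)
      show "distr M borel (\<lambda>\<omega>. g (\<xi> i \<omega>)) = distr M borel (\<lambda>\<omega>. g (\<xi> 1 \<omega>))" if "i \<in> {1..n}" for i
        using distr_distr[OF g(1) measurable_sample[of i]] distr_distr[OF g(1) measurable_sample[of 1]] that
        by (simp add: distr_sample comp_def)
      show "random_variable borel (\<lambda>\<omega>. g (\<xi> 1 \<omega>))"
        by (rule measurable_compose[OF measurable_sample g(1)]) simp
      show "AE x in M. g (\<xi> 1 x) \<in> {- K'..K'}"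
        using K'(1) unfolding abs_le_iff atLeastAtMost_iff by (intro AE_I2) (metis minus_le_iff)
    qed simp_all
    have E: "expectation (\<lambda>\<omega>. g (\<xi> 1 \<omega>)) = (\<integral>s. g s \<partial>S)"
      by (rule expectation_sample[OF int]) simp
    have "2 * exp (-2 * real n * \<tau>\<^sup>2 / (K' - - K')\<^sup>2) = 2 * exp (- c * real n)"
      by (simp add: c_def)
    moreover have "0 \<le> \<tau>" "- K' < K'" "{1..n} \<noteq> {}" using \<open>\<tau> > 0\<close> K'(2) n by auto
    note H.Hoeffding_ineq_abs_ge'[OF this]
    ultimately show ?thesis
      unfolding E card_atLeastAtMost diff_Suc_1 by argo
  qed
  have "c > 0" using \<open>\<tau> > 0\<close> K'(2) by (simp add: c_def)
  then have "(\<lambda>n. 2 * exp (- c * real n)) \<longlonglongrightarrow> 0"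
    by real_asymp
  from real_tendsto_sandwich[OF _ eventually_mono[OF eventually_gt_at_top[of 0] le] tendsto_const this]
  show ?thesis by simp
qed

text \<open>Truncation reduces integrable functions to bounded ones: the truncated part
  \<open>h\<close> obeys the bounded law, and the mean of the remainder \<open>r\<close> is small in
  probability by Markov's inequality.\<close>

lemma weak_law:
  fixes g :: "'b \<Rightarrow> real" and \<tau> :: real
  assumes int: "integrable S g" and "\<tau> > 0"
  shows "(\<lambda>n. prob {\<omega> \<in> space M. \<bar>(\<Sum>i=1..n. g (\<xi> i \<omega>)) / n - (\<integral>s. g s \<partial>S)\<bar> \<ge> \<tau>}) \<longlonglongrightarrow> 0"
proof (rule order_tendstoI)
  fix e :: real assume "e > 0"
  \<comment> \<open>The bound \<open>\<tau> / 3\<close> controls the change of expectation under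
    truncation; the bound \<open>e * \<tau> / 6\<close> makes the Markov estimate at level
    \<open>\<tau> / 3\<close> at most \<open>e / 2\<close>.\<close>
  define \<theta> where "\<theta> = min (\<tau> / 3) (e * \<tau> / 6)"
  have \<theta>: "\<theta> > 0" "\<theta> \<le> \<tau> / 3" "\<theta> * (3 / \<tau>) \<le> e / 2"
    using \<open>e > 0\<close> \<open>\<tau> > 0\<close> by (auto simp: \<theta>_def min_def field_simps)
  obtain k :: nat where k: "(\<integral>s. \<bar>g s - max (- real k) (min (real k) (g s))\<bar> \<partial>S) < \<theta>"
    using order_tendstoD(2)[OF integral_truncation_error[OF int] \<theta>(1)] by (auto simp: eventually_sequentially)
  define h where "h = (\<lambda>s. max (- real k) (min (real k) (g s)))"
  define r where "r = (\<lambda>s. \<bar>g s - h s\<bar>)"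
  have mh: "h \<in> borel_measurable S" "\<And>s. \<bar>h s\<bar> \<le> k" using int by (auto simp: h_def)
  have ih: "integrable S h" using mh by (intro S.integrable_const_bound[of _ k]) auto
  have ir: "integrable S r" unfolding r_def using int ih by simp
  have r: "(\<integral>s. r s \<partial>S) < \<theta>" using k by (simp add: r_def h_def)
  define m where "m = (\<lambda>(f :: 'b \<Rightarrow> real) n \<omega>. (\<Sum>i=1..n. f (\<xi> i \<omega>)) / real n)"
  have meas: "m f n \<in> borel_measurable M" if "integrable S f" for f n
    unfolding m_def by (rule measurable_sample_mean) (use that in auto)
  have Eg: "\<bar>(\<integral>s. g s \<partial>S) - (\<integral>s. h s \<partial>S)\<bar> < \<tau> / 3"
  proof -
    have "\<bar>(\<integral>s. g s \<partial>S) - (\<integral>s. h s \<partial>S)\<bar> = \<bar>\<integral>s. g s - h s \<partial>S\<bar>" using int ih by simp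
    also have "\<dots> \<le> (\<integral>s. r s \<partial>S)" unfolding r_def by (rule integral_abs_bound)
    finally show ?thesis using r \<theta> by simp
  qed
  have markov: "prob {\<omega> \<in> space M. m r n \<omega> \<ge> \<tau> / 3} \<le> e / 2" if n: "n > 0" for n
  proof -
    have im: "integrable M (m r n)"
      unfolding m_def using integrable_sample[OF ir] by (intro integrable_divide integrable_sum) auto
    have "expectation (m r n) = (\<Sum>i=1..n. (\<integral>s. r s \<partial>S)) / n"
      unfolding m_def using integrable_sample[OF ir] expectation_sample[OF ir] by simp
    then have "expectation (m r n) < \<theta>" using n r by simp
    moreover have "prob {\<omega> \<in> space M. m r n \<omega> \<ge> \<tau> / 3} \<le> expectation (m r n) / (\<tau> / 3)"
      using \<open>\<tau> > 0\<close> by (intro integral_Markov_inequality_measure[OF im, where A = "{}"])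
        (auto simp: m_def r_def intro!: divide_nonneg_nonneg sum_nonneg)
    ultimately have "prob {\<omega> \<in> space M. m r n \<omega> \<ge> \<tau> / 3} \<le> \<theta> * (3 / \<tau>)"
      using \<open>\<tau> > 0\<close> by (simp add: field_simps)
    with \<theta> show ?thesis by simp
  qed
  have "\<forall>\<^sub>F n in sequentially. prob {\<omega> \<in> space M. \<bar>m h n \<omega> - (\<integral>s. h s \<partial>S)\<bar> \<ge> \<tau> / 3} < e / 2"
    unfolding m_def using \<open>e > 0\<close> \<open>\<tau> > 0\<close>
    by (intro order_tendstoD(2)[OF weak_law_bounded[OF mh]]) auto
  then show "\<forall>\<^sub>F n in sequentially.
      prob {\<omega> \<in> space M. \<bar>(\<Sum>i=1..n. g (\<xi> i \<omega>)) / n - (\<integral>s. g s \<partial>S)\<bar> \<ge> \<tau>} < e"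
    using eventually_gt_at_top[of 0]
  proof eventually_elim
    case (elim n)
    let ?A = "{\<omega> \<in> space M. \<bar>m h n \<omega> - (\<integral>s. h s \<partial>S)\<bar> \<ge> \<tau> / 3}"
    let ?B = "{\<omega> \<in> space M. m r n \<omega> \<ge> \<tau> / 3}"
    have m3: "\<bar>m g n \<omega> - m h n \<omega>\<bar> \<le> m r n \<omega>" for \<omega>
      unfolding m_def r_def
      by (simp add: divide_right_mono sum_abs flip: diff_divide_distrib sum_subtractf)
    \<comment> \<open>A deviation of \<open>\<tau>\<close> splits into three thirds: sample
      remainder, deviation of the truncated mean, and difference of expectations. The last is always
      strictly below \<open>\<tau> / 3\<close>, so one of the first two must be large.\<close>
    have "{\<omega> \<in> space M. \<bar>m g n \<omega> - (\<integral>s. g s \<partial>S)\<bar> \<ge> \<tau>} \<subseteq> ?A \<union> ?B"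
    proof (safe, goal_cases)
      case (1 \<omega>)
      then show ?case using m3[of \<omega>] Eg by linarith
    qed
    then have "prob {\<omega> \<in> space M. \<bar>m g n \<omega> - (\<integral>s. g s \<partial>S)\<bar> \<ge> \<tau>} \<le> prob (?A \<union> ?B)"
      using meas[OF ih] meas[OF ir] by (intro finite_measure_mono) auto
    also have "\<dots> \<le> prob ?A + prob ?B"
      using meas[OF ih] meas[OF ir] by (intro measure_Un_le) auto
    also have "\<dots> < e" using elim markov[of n] by simp
    finally show ?case by (simp add: m_def)
  qed
qed (intro always_eventually allI less_le_trans[OF _ measure_nonneg])

text \<open>A union bound and Markov's inequality for the moment of order
  \<open>1 + \<epsilon>\<close> give \<open>n\<close> terms of size
  \<open>C / (n * \<tau>) powr (1 + \<epsilon>)\<close>, hence a bound of order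
  \<open>n powr (- \<epsilon>)\<close>.\<close>

lemma prob_sample_max_tendsto_0:
  fixes Z :: "'b \<Rightarrow> real" and \<epsilon> \<tau> :: real
  assumes Z: "Z \<in> borel_measurable S" "\<And>s. s \<in> space S \<Longrightarrow> 0 \<le> Z s"
    and int: "integrable S (\<lambda>s. Z s powr (1 + \<epsilon>))" and "\<epsilon> > 0" "\<tau> > 0"
  shows "(\<lambda>n. prob {\<omega> \<in> space M. \<exists>i\<in>{1..n}. Z (\<xi> i \<omega>) > n * \<tau>}) \<longlonglongrightarrow> 0"
proof -
  define C where "C = (\<integral>s. Z s powr (1 + \<epsilon>) \<partial>S)"
  have le: "prob {\<omega> \<in> space M. \<exists>i\<in>{1..n}. Z (\<xi> i \<omega>) > n * \<tau>}
      \<le> C / \<tau> powr (1 + \<epsilon>) * real n powr (- \<epsilon>)" if n: "n > 0" for n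
  proof -
    have "{\<omega> \<in> space M. \<exists>i\<in>{1..n}. Z (\<xi> i \<omega>) > n * \<tau>}
        = (\<Union>i\<in>{1..n}. {\<omega> \<in> space M. Z (\<xi> i \<omega>) > n * \<tau>})" by auto
    also have "prob \<dots> \<le> (\<Sum>i\<in>{1..n}. prob {\<omega> \<in> space M. Z (\<xi> i \<omega>) > n * \<tau>})"
      using measurable_compose[OF measurable_sample Z(1)]
      by (intro finite_measure_subadditive_finite) auto
    also have "\<dots> \<le> (\<Sum>i\<in>{1..n}. C / (n * \<tau>) powr (1 + \<epsilon>))"
    proof (rule sum_mono)
      fix i assume i: "i \<in> {1..n}"
      have "prob {\<omega> \<in> space M. Z (\<xi> i \<omega>) > n * \<tau>}
          \<le> prob {\<omega> \<in> space M. Z (\<xi> i \<omega>) powr (1 + \<epsilon>) \<ge> (n * \<tau>) powr (1 + \<epsilon>)}"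
        using i assms integrable_sample[OF int, of i]
        by (intro finite_measure_mono) (auto intro!: powr_mono2)
      also have "\<dots> \<le> expectation (\<lambda>\<omega>. Z (\<xi> i \<omega>) powr (1 + \<epsilon>)) / (n * \<tau>) powr (1 + \<epsilon>)"
        using i n \<open>\<tau> > 0\<close> integrable_sample[OF int, of i]
        by (intro integral_Markov_inequality_measure[where A = "{}"]) auto
      also have "\<dots> = C / (n * \<tau>) powr (1 + \<epsilon>)"
        using i expectation_sample[OF int, of i] by (simp add: C_def)
      finally show "prob {\<omega> \<in> space M. Z (\<xi> i \<omega>) > n * \<tau>} \<le> C / (n * \<tau>) powr (1 + \<epsilon>)" .
    qed
    also have "\<dots> = C / \<tau> powr (1 + \<epsilon>) * real n powr (- \<epsilon>)"
      using n \<open>\<tau> > 0\<close> by (simp add: powr_mult powr_add powr_minus field_simps)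
    finally show ?thesis .
  qed
  have "(\<lambda>n. C / \<tau> powr (1 + \<epsilon>) * real n powr (- \<epsilon>)) \<longlonglongrightarrow> 0"
    using \<open>\<epsilon> > 0\<close> by real_asymp
  from real_tendsto_sandwich[OF _ eventually_mono[OF eventually_gt_at_top[of 0] le] tendsto_const this]
  show ?thesis by simp
qed

end

subsection \<open>Finite bracketing of dominated continuous losses\<close>

text \<open>Measurability of \<open>Z\<close> is recovered by taking the root of its power, and
  \<open>Z \<le> 1 + Z powr (1 + \<epsilon>)\<close> gives a dominating function on a finite measure
  space.\<close>

lemma integrable_if_powr_integrable:
  fixes Z :: "'b \<Rightarrow> real"
  assumes "finite_measure S" "\<And>s. s \<in> space S \<Longrightarrow> 0 \<le> Z s" "0 < \<epsilon>"
    and int: "integrable S (\<lambda>s. Z s powr (1 + \<epsilon>))"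
  shows "integrable S Z"
proof -
  have "(\<lambda>s. (Z s powr (1 + \<epsilon>)) powr (1 / (1 + \<epsilon>))) \<in> borel_measurable S"
    using borel_measurable_integrable[OF int] by measurable
  then have meas: "Z \<in> borel_measurable S"
    using assms(2,3) by (subst (asm) measurable_cong[where g = Z]) (auto simp: powr_powr)
  have le: "Z s \<le> 1 + Z s powr (1 + \<epsilon>)" if "0 \<le> Z s" for s
  proof (cases "Z s \<le> 1")
    case False
    then have "Z s powr 1 \<le> Z s powr (1 + \<epsilon>)" using assms(3) by (intro powr_mono) auto
    then show ?thesis using that by simp
  qed (simp add: add_increasing2)
  have "integrable S (\<lambda>s. 1 + Z s powr (1 + \<epsilon>))"
    using int assms(1) by (intro Bochner_Integration.integrable_add) (auto simp: finite_measure.integrable_const)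
  then show ?thesis
    by (rule Bochner_Integration.integrable_bound[OF _ meas AE_I2]) (use assms(2) le in force)
qed

locale dominated_loss = S: finite_measure S
  for S :: "'b measure" and X :: "'a::{metric_space, second_countable_topology} set"
    and l :: "'a \<Rightarrow> 'b \<Rightarrow> real" and Z :: "'b \<Rightarrow> real" +
  assumes compact_X: "compact X"
    and measurable_loss: "\<And>y. y \<in> X \<Longrightarrow> l y \<in> borel_measurable S"
    and continuous_loss: "\<And>s. s \<in> space S \<Longrightarrow> continuous_on X (\<lambda>y. l y s)"
    and loss_bound: "\<And>y s. y \<in> X \<Longrightarrow> s \<in> space S \<Longrightarrow> \<bar>l y s\<bar> \<le> Z s"
    and integrable_Z: "integrable S Z"
begin

lemma integrable_loss: "y \<in> X \<Longrightarrow> integrable S (l y)"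
  using loss_bound by (intro Bochner_Integration.integrable_bound[OF integrable_Z measurable_loss]) force+

text \<open>The supremum of the oscillation is taken over a countable dense subset of \<open>X\<close>, which keeps it
  measurable.\<close>

lemma small_oscillation:
  assumes x: "x \<in> X" and "e > 0"
  obtains d \<phi> where "d > 0" "integrable S \<phi>" "(\<integral>s. \<phi> s \<partial>S) < e"
    "\<And>y s. y \<in> X \<Longrightarrow> dist y x < d \<Longrightarrow> s \<in> space S \<Longrightarrow> \<bar>l y s - l x s\<bar> \<le> \<phi> s"
proof -
  obtain T where T: "countable T" "T \<subseteq> X" "X \<subseteq> closure T" by (rule separable)
  \<comment> \<open>Including the centre \<open>x\<close> keeps \<open>I k\<close> nonempty and
    makes the supremum \<open>\<phi> k\<close> nonnegative.\<close>
  define I where "I = (\<lambda>k::nat. insert x (T \<inter> ball x (1 / Suc k)))"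
  have I: "I k \<subseteq> X" "countable (I k)" "I k \<noteq> {}" "\<And>y. y \<in> I k \<Longrightarrow> dist y x < 1 / Suc k" for k
    using T x by (auto simp: I_def dist_commute)
  define \<phi> where "\<phi> = (\<lambda>k s. SUP y\<in>I k. \<bar>l y s - l x s\<bar>)"
  have bound: "\<bar>l y s - l x s\<bar> \<le> 2 * Z s" if "y \<in> X" "s \<in> space S" for y s
    using loss_bound[OF that] loss_bound[OF x that(2)] by linarith
  have bdd: "bdd_above ((\<lambda>y. \<bar>l y s - l x s\<bar>) ` I k)" if "s \<in> space S" for k s
    using bound that I(1) by (intro bdd_aboveI2[of _ _ "2 * Z s"]) auto
  have \<phi>_upper: "\<bar>l y s - l x s\<bar> \<le> \<phi> k s" if "y \<in> I k" "s \<in> space S" for y k s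
    unfolding \<phi>_def using that by (intro cSUP_upper bdd)
  have \<phi>_0: "0 \<le> \<phi> k s" if "s \<in> space S" for k s
    using \<phi>_upper[of x k s] that by (simp add: I_def)
  have \<phi>_2Z: "\<phi> k s \<le> 2 * Z s" if "s \<in> space S" for k s
    unfolding \<phi>_def using that I(1) bound by (intro cSUP_least I(3)) auto
  have meas: "\<phi> k \<in> borel_measurable S" for k
    unfolding \<phi>_def using I(1)[of k] measurable_loss x
    by (intro borel_measurable_cSUP[OF I(2) _ bdd] borel_measurable_abs borel_measurable_diff) auto
  have "(\<lambda>k. \<integral>s. \<phi> k s \<partial>S) \<longlonglongrightarrow> (\<integral>s. 0 \<partial>S)"
  proof (rule integral_dominated_convergence[where w = "\<lambda>s. 2 * Z s"])
    show "integrable S (\<lambda>s. 2 * Z s)" using integrable_Z by simp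
    show "AE s in S. norm (\<phi> k s) \<le> 2 * Z s" for k
      using \<phi>_0 \<phi>_2Z by (intro AE_I2) simp
    show "AE s in S. (\<lambda>k. \<phi> k s) \<longlonglongrightarrow> 0"
    proof (rule AE_I2)
      fix s assume s: "s \<in> space S"
      show "(\<lambda>k. \<phi> k s) \<longlonglongrightarrow> 0"
      proof (rule order_tendstoI)
        fix a :: real assume "a > 0"
        \<comment> \<open>The tolerance is halved because a supremum of values below
          \<open>a / 2\<close> may equal \<open>a / 2\<close>.\<close>
        then obtain d where d: "d > 0" "\<And>y. y \<in> X \<Longrightarrow> dist y x < d \<Longrightarrow> dist (l y s) (l x s) < a / 2"
          using continuous_loss[OF s] x unfolding continuous_on_iff by (metis half_gt_zero)
        obtain k0 where k0: "1 / Suc k0 < d" using d(1) nat_approx_posE by blast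
        show "\<forall>\<^sub>F k in sequentially. \<phi> k s < a"
        proof (rule eventually_sequentiallyI[of k0])
          fix k assume "k0 \<le> k"
          then have "1 / Suc k \<le> 1 / Suc k0" by (intro divide_left_mono) auto
          then have "\<phi> k s \<le> a / 2"
            unfolding \<phi>_def using I(1)[of k] I(4)[of _ k] k0 d(2)
            by (intro cSUP_least I(3)) (force simp: dist_real_def)
          then show "\<phi> k s < a" using \<open>a > 0\<close> by simp
        qed
      next
        fix a :: real assume "a < 0"
        then show "\<forall>\<^sub>F k in sequentially. a < \<phi> k s"
          by (intro always_eventually allI less_le_trans[OF _ \<phi>_0[OF s]])
      qed
    qed
  qed (use meas in auto)
  then have "\<forall>\<^sub>F k in sequentially. (\<integral>s. \<phi> k s \<partial>S) < e"
    using \<open>e > 0\<close> by (intro order_tendstoD(2)) auto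
  then obtain k where k: "(\<integral>s. \<phi> k s \<partial>S) < e" by (auto simp: eventually_sequentially)
  show ?thesis
  proof
    show "integrable S (\<phi> k)"
      using \<phi>_0 order_trans[OF \<phi>_2Z abs_ge_self] integrable_Z
      by (intro Bochner_Integration.integrable_bound[of S "\<lambda>s. 2 * Z s", OF _ meas] AE_I2) auto
    fix y s assume y: "y \<in> X" "dist y x < 1 / Suc k" and s: "s \<in> space S"
    \<comment> \<open>A point \<open>y\<close> outside the dense set is approached from within it;
      the approximants eventually enter the open ball, and continuity of the loss carries the bound
      to \<open>y\<close>.\<close>
    obtain u where u: "\<And>n. u n \<in> T" "u \<longlonglongrightarrow> y"
      using y(1) T(3) closure_sequential[of y T] by blast
    have "\<forall>\<^sub>F n in sequentially. u n \<in> ball x (1 / Suc k)"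
      using y(2) by (intro topological_tendstoD[OF u(2)]) (auto simp: dist_commute)
    then have ev: "\<forall>\<^sub>F n in sequentially. \<bar>l (u n) s - l x s\<bar> \<le> \<phi> k s"
      by eventually_elim (use u(1) s in \<open>auto intro!: \<phi>_upper simp: I_def\<close>)
    have "(\<lambda>n. l (u n) s) \<longlonglongrightarrow> l y s"
      using subsetD[OF T(2) u(1)] by (intro continuous_on_tendsto_compose[OF continuous_loss[OF s] u(2) y(1)]) simp
    then have "(\<lambda>n. \<bar>l (u n) s - l x s\<bar>) \<longlonglongrightarrow> \<bar>l y s - l x s\<bar>"
      by (intro tendsto_intros)
    from tendsto_upperbound[OF this ev] show "\<bar>l y s - l x s\<bar> \<le> \<phi> k s" by simp
  qed (use k in auto)
qed

lemma continuous_expected_loss: "continuous_on X (\<lambda>y. \<integral>s. l y s \<partial>S)"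
  unfolding continuous_on_iff
proof (intro ballI allI impI)
  fix x e assume x: "x \<in> X" and "(0::real) < e"
  then obtain d \<phi> where d: "d > 0" "integrable S \<phi>" "(\<integral>s. \<phi> s \<partial>S) < e"
    "\<And>y s. y \<in> X \<Longrightarrow> dist y x < d \<Longrightarrow> s \<in> space S \<Longrightarrow> \<bar>l y s - l x s\<bar> \<le> \<phi> s"
    by (rule small_oscillation) blast
  have "dist (\<integral>s. l y s \<partial>S) (\<integral>s. l x s \<partial>S) < e" if y: "y \<in> X" "dist y x < d" for y
  proof -
    have "dist (\<integral>s. l y s \<partial>S) (\<integral>s. l x s \<partial>S) = \<bar>\<integral>s. l y s - l x s \<partial>S\<bar>"
      using x y by (simp add: integrable_loss dist_real_def)
    also have "\<dots> \<le> (\<integral>s. \<bar>l y s - l x s\<bar> \<partial>S)" by (rule integral_abs_bound)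
    also have "\<dots> \<le> (\<integral>s. \<phi> s \<partial>S)"
      using x y d integrable_loss by (intro integral_mono) auto
    finally show ?thesis using d(3) by simp
  qed
  with d(1) show "\<exists>d>0. \<forall>y\<in>X. dist y x < d \<longrightarrow> dist (\<integral>s. l y s \<partial>S) (\<integral>s. l x s \<partial>S) < e" by blast
qed

text \<open>Balls on which the oscillation envelope has small integral cover \<open>X\<close>, and
  compactness selects finitely many. \<open>F\<close> collects the losses at the centres together
  with their envelopes, so finitely many laws of large numbers control all decisions at
  once.\<close>

lemma finite_bracketing:
  assumes "e > 0"
  obtains F where "finite F" "\<And>g. g \<in> F \<Longrightarrow> integrable S g"
    "\<And>y. y \<in> X \<Longrightarrow> \<exists>g\<in>F. \<exists>\<phi>\<in>F. (\<forall>s\<in>space S. \<bar>l y s - g s\<bar> \<le> \<phi> s) \<and> (\<integral>s. \<phi> s \<partial>S) < e"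
proof -
  have "\<exists>d \<phi>. d > 0 \<and> integrable S \<phi> \<and> (\<integral>s. \<phi> s \<partial>S) < e \<and>
      (\<forall>y s. y \<in> X \<longrightarrow> dist y x < d \<longrightarrow> s \<in> space S \<longrightarrow> \<bar>l y s - l x s\<bar> \<le> \<phi> s)" if "x \<in> X" for x
    by (rule small_oscillation[OF that assms]) blast
  then obtain d \<phi> where d: "\<And>x. x \<in> X \<Longrightarrow> d x > 0" "\<And>x. x \<in> X \<Longrightarrow> integrable S (\<phi> x)"
      "\<And>x. x \<in> X \<Longrightarrow> (\<integral>s. \<phi> x s \<partial>S) < e"
      "\<And>x y s. x \<in> X \<Longrightarrow> y \<in> X \<Longrightarrow> dist y x < d x \<Longrightarrow> s \<in> space S \<Longrightarrow> \<bar>l y s - l x s\<bar> \<le> \<phi> x s"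
    by metis
  obtain C where C: "C \<subseteq> X" "finite C" "X \<subseteq> (\<Union>x\<in>C. ball x (d x))"
    using compactE_image[OF compact_X, of X "\<lambda>x. ball x (d x)"] d(1) by force
  show ?thesis
  proof
    show "finite (l ` C \<union> \<phi> ` C)" using C by simp
    show "integrable S g" if "g \<in> l ` C \<union> \<phi> ` C" for g
      using that C(1) d(2) integrable_loss by auto
    fix y assume y: "y \<in> X"
    then obtain x where x: "x \<in> C" "dist y x < d x" using C(3) by (force simp: dist_commute)
    then have "(\<forall>s\<in>space S. \<bar>l y s - l x s\<bar> \<le> \<phi> x s) \<and> (\<integral>s. \<phi> x s \<partial>S) < e"
      using d(3,4) y C(1) by blast
    with x(1) show "\<exists>g\<in>l ` C \<union> \<phi> ` C. \<exists>\<phi>'\<in>l ` C \<union> \<phi> ` C.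
        (\<forall>s\<in>space S. \<bar>l y s - g s\<bar> \<le> \<phi>' s) \<and> (\<integral>s. \<phi>' s \<partial>S) < e"
      by blast
  qed
qed

end

subsection \<open>Uniform convergence of the robust risk\<close>

text \<open>\<open>B n\<close> is the bad event that some mean over the finite family
  \<open>G\<close> strays from its expectation or that the sample maximum of \<open>Z\<close>
  exceeds \<open>n * \<tau>'\<close>. Off \<open>B n\<close> the argument is deterministic, so no
  measurability of the robust risk enters. The error \<open>e\<close> is spent as
  \<open>e / 2\<close> on the empirical mean, \<open>e / 4\<close> on the \<open>\<eta>\<close> term
  and \<open>e / 4\<close> on the maximum term.\<close>

lemma (in iid_sample) robust_risk_uniform_convergence:
  fixes l :: "'a::{metric_space, second_countable_topology} \<Rightarrow> 'b \<Rightarrow> real" and \<rho> \<epsilon> e :: real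
  assumes loss: "dominated_loss S X l Z" and f: "smooth_divergence_generator f"
    and "0 < \<rho>" "0 < \<epsilon>" and Z0: "\<And>s. s \<in> space S \<Longrightarrow> 0 \<le> Z s"
    and int: "integrable S (\<lambda>s. Z s powr (1 + \<epsilon>))" and "0 < e"
  obtains B where "\<And>n. B n \<in> events" "(\<lambda>n. prob (B n)) \<longlonglongrightarrow> 0"
    "\<And>n \<omega> y. n > 0 \<Longrightarrow> \<omega> \<in> space M - B n \<Longrightarrow> y \<in> X \<Longrightarrow>
      ereal ((\<integral>s. l y s \<partial>S) - e) \<le> robust_risk f (\<rho> / n) (empirical_measure S n (\<lambda>i. \<xi> i \<omega>)) l y \<and>
      robust_risk f (\<rho> / n) (empirical_measure S n (\<lambda>i. \<xi> i \<omega>)) l y \<le> ereal ((\<integral>s. l y s \<partial>S) + e)"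
proof -
  interpret L: dominated_loss S X l Z by (rule loss)
  define m where "m = (\<lambda>(g :: 'b \<Rightarrow> real) n \<omega>. (\<Sum>i=1..n. g (\<xi> i \<omega>)) / real n)"
  define EZ where "EZ = (\<integral>s. Z s \<partial>S)"
  have EZ: "EZ \<ge> 0" unfolding EZ_def using Z0 by (intro integral_nonneg_AE AE_I2)
  \<comment> \<open>Chosen so that \<open>\<eta>\<close> times the sample mean of \<open>Z\<close>
    costs at most \<open>e / 4\<close> once that mean is below \<open>EZ + 1\<close>; the added 1
    also keeps the denominator positive when \<open>EZ = 0\<close>.\<close>
  define \<eta> where "\<eta> = e / (4 * (EZ + 1))"
  have \<eta>: "\<eta> > 0" "\<eta> * (EZ + 1) = e / 4" using EZ \<open>0 < e\<close> by (auto simp: \<eta>_def divide_simps)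
  obtain \<kappa> where \<kappa>: "\<kappa> > 0" "\<And>t. 0 \<le> t \<Longrightarrow> ereal (\<kappa> * max 0 (\<bar>t - 1\<bar> - \<eta>)) \<le> f t"
    by (rule divergence_generator_minorant[OF f \<eta>(1)]) blast
  have f1: "f 1 = 0" using f by (simp add: smooth_divergence_generator_def)
  define \<tau> where "\<tau> = min (e / 8) 1"
  \<comment> \<open>With \<open>b = n * \<tau>'\<close> the term
    \<open>b * \<rho> / (\<kappa> * n)\<close> of the deviation bound equals
    \<open>e / 4\<close>.\<close>
  define \<tau>' where "\<tau>' = e * \<kappa> / (4 * \<rho>)"
  have \<tau>: "0 < \<tau>" "\<tau> \<le> e / 8" "\<tau> \<le> 1" "0 < \<tau>'"
    using \<open>0 < e\<close> \<open>0 < \<rho>\<close> \<kappa>(1) by (auto simp: \<tau>_def \<tau>'_def)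
  obtain F where F: "finite F" "\<And>g. g \<in> F \<Longrightarrow> integrable S g"
    "\<And>y. y \<in> X \<Longrightarrow> \<exists>g\<in>F. \<exists>\<phi>\<in>F. (\<forall>s\<in>space S. \<bar>l y s - g s\<bar> \<le> \<phi> s) \<and> (\<integral>s. \<phi> s \<partial>S) < e / 8"
    by (rule L.finite_bracketing[of "e / 8"]) (use \<open>0 < e\<close> in auto)
  \<comment> \<open>\<open>Z\<close> joins the family because its sample mean multiplies
    \<open>\<eta>\<close> in the deviation bound.\<close>
  define G where "G = insert Z F"
  have G: "finite G" "\<And>g. g \<in> G \<Longrightarrow> integrable S g" using F L.integrable_Z by (auto simp: G_def)
  define D where "D = (\<lambda>g n. {\<omega> \<in> space M. \<bar>m g n \<omega> - (\<integral>s. g s \<partial>S)\<bar> \<ge> \<tau>})"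
  define H where "H = (\<lambda>n. {\<omega> \<in> space M. \<exists>i\<in>{1..n}. Z (\<xi> i \<omega>) > n * \<tau>'})"
  have D: "D g n \<in> events" "(\<lambda>n. prob (D g n)) \<longlonglongrightarrow> 0" if "g \<in> G" for g n
  proof -
    have "m g n \<in> borel_measurable M"
      unfolding m_def by (rule measurable_sample_mean) (use G(2)[OF that] in auto)
    then show "D g n \<in> events" unfolding D_def by measurable
    show "(\<lambda>n. prob (D g n)) \<longlonglongrightarrow> 0" unfolding D_def m_def by (rule weak_law[OF G(2)[OF that] \<tau>(1)])
  qed
  have mZ: "Z \<in> borel_measurable S" using L.integrable_Z by simp
  have H: "H n \<in> events" for n
  proof -
    have "(\<lambda>\<omega>. Z (\<xi> i \<omega>)) \<in> borel_measurable M" if "i \<in> {1..n}" for i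
      using that by (intro measurable_compose[OF measurable_sample mZ]) auto
    then have "(\<Union>i\<in>{1..n}. {\<omega> \<in> space M. Z (\<xi> i \<omega>) > n * \<tau>'}) \<in> events" by auto
    also have "(\<Union>i\<in>{1..n}. {\<omega> \<in> space M. Z (\<xi> i \<omega>) > n * \<tau>'}) = H n" by (auto simp: H_def)
    finally show ?thesis .
  qed
  have H_lim: "(\<lambda>n. prob (H n)) \<longlonglongrightarrow> 0"
    unfolding H_def using \<tau> by (intro prob_sample_max_tendsto_0[OF mZ Z0 int \<open>0 < \<epsilon>\<close>]) auto
  define B where "B = (\<lambda>n. (\<Union>g\<in>G. D g n) \<union> H n)"
  have B: "B n \<in> events" for n unfolding B_def by (intro sets.Un sets.finite_UN G(1) D(1) H)
  have lim: "(\<lambda>n. (\<Sum>g\<in>G. prob (D g n)) + prob (H n)) \<longlonglongrightarrow> 0"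
    using tendsto_add[OF tendsto_null_sum[OF D(2)] H_lim] by simp
  have le: "prob (B n) \<le> (\<Sum>g\<in>G. prob (D g n)) + prob (H n)" for n
  proof -
    have "prob (B n) \<le> prob (\<Union>g\<in>G. D g n) + prob (H n)"
      unfolding B_def by (intro measure_Un_le sets.finite_UN G(1) D(1) H)
    also have "prob (\<Union>g\<in>G. D g n) \<le> (\<Sum>g\<in>G. prob (D g n))"
      using G(1) D(1) by (intro finite_measure_subadditive_finite image_subsetI)
    finally show ?thesis by simp
  qed
  from real_tendsto_sandwich[OF _ always_eventually[OF allI[OF le]] tendsto_const lim]
  have B_lim: "(\<lambda>n. prob (B n)) \<longlonglongrightarrow> 0" by simp
  show ?thesis
  proof (rule that[OF B B_lim])
    fix n \<omega> y assume n: "n > 0" and \<omega>: "\<omega> \<in> space M - B n" and y: "y \<in> X"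
    have sp: "\<xi> i \<omega> \<in> space S" if "i \<in> {1..n}" for i
      using that \<omega> sample_in_space[of i \<omega>] by auto
    have dev: "\<bar>m g n \<omega> - (\<integral>s. g s \<partial>S)\<bar> < \<tau>" if "g \<in> G" for g
      using \<omega> that by (auto simp: B_def D_def)
    have Zb: "Z (\<xi> i \<omega>) \<le> n * \<tau>'" if "i \<in> {1..n}" for i
      using \<omega> that by (force simp: B_def H_def)
    obtain g \<phi> where g: "g \<in> F" "\<phi> \<in> F" "\<And>s. s \<in> space S \<Longrightarrow> \<bar>l y s - g s\<bar> \<le> \<phi> s"
        "(\<integral>s. \<phi> s \<partial>S) < e / 8"
      using F(3)[OF y] by blast
    have "\<bar>m (l y) n \<omega> - m g n \<omega>\<bar> \<le> m \<phi> n \<omega>"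
    proof -
      have "\<bar>\<Sum>i=1..n. l y (\<xi> i \<omega>) - g (\<xi> i \<omega>)\<bar> \<le> (\<Sum>i=1..n. \<phi> (\<xi> i \<omega>))"
        by (intro order_trans[OF sum_abs] sum_mono g(3) sp)
      then show ?thesis
        by (simp add: m_def divide_right_mono sum_subtractf flip: diff_divide_distrib)
    qed
    moreover have "\<bar>(\<integral>s. l y s \<partial>S) - (\<integral>s. g s \<partial>S)\<bar> \<le> (\<integral>s. \<phi> s \<partial>S)"
    proof -
      have "\<bar>(\<integral>s. l y s \<partial>S) - (\<integral>s. g s \<partial>S)\<bar> = \<bar>\<integral>s. l y s - g s \<partial>S\<bar>"
        using L.integrable_loss[OF y] F(2) g by simp
      also have "\<dots> \<le> (\<integral>s. \<bar>l y s - g s\<bar> \<partial>S)" by (rule integral_abs_bound)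
      also have "\<dots> \<le> (\<integral>s. \<phi> s \<partial>S)"
        using L.integrable_loss[OF y] F(2) g by (intro integral_mono) auto
      finally show ?thesis .
    qed
    moreover have "\<bar>m g n \<omega> - (\<integral>s. g s \<partial>S)\<bar> < \<tau>" "\<bar>m \<phi> n \<omega> - (\<integral>s. \<phi> s \<partial>S)\<bar> < \<tau>"
      using g(1,2) by (auto intro!: dev simp: G_def)
    \<comment> \<open>Four errors of at most \<open>e / 8\<close> add up: the integral of
      \<open>\<phi>\<close> enters twice, once through its sample mean, and \<open>\<tau>\<close>
      enters for \<open>g\<close> and for \<open>\<phi>\<close>.\<close>
    ultimately have mean: "\<bar>m (l y) n \<omega> - (\<integral>s. l y s \<partial>S)\<bar> \<le> e / 2"
      using g(4) \<tau>(2) by linarith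
    have "\<bar>m Z n \<omega> - EZ\<bar> < \<tau>" unfolding EZ_def by (rule dev) (simp add: G_def)
    then have "m Z n \<omega> \<le> EZ + 1" using \<tau>(3) by linarith
    then have "\<eta> * m Z n \<omega> \<le> \<eta> * (EZ + 1)" using \<eta>(1) by (intro mult_left_mono) auto
    moreover have "n * \<tau>' * \<rho> / (\<kappa> * n) = e / 4"
      using n \<kappa>(1) \<open>0 < \<rho>\<close> by (simp add: \<tau>'_def)
    moreover have mean': "m (l y) n \<omega> \<le> (\<integral>s. l y s \<partial>S) + e / 2" "(\<integral>s. l y s \<partial>S) - e / 2 \<le> m (l y) n \<omega>"
      using mean unfolding abs_le_iff by (simp_all only: diff_le_eq minus_diff_eq add.commute)
    ultimately have le: "m (l y) n \<omega> + \<eta> * m Z n \<omega> + n * \<tau>' * \<rho> / (\<kappa> * n) \<le> (\<integral>s. l y s \<partial>S) + e"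
      using \<eta>(2) by simp
    have ge: "(\<integral>s. l y s \<partial>S) - e \<le> m (l y) n \<omega>"
      using mean'(2) \<open>0 < e\<close> by simp
    have lb: "\<And>i. i \<in> {1..n} \<Longrightarrow> \<bar>l y (\<xi> i \<omega>)\<bar> \<le> Z (\<xi> i \<omega>)"
      using L.loss_bound y sp by auto
    have b: "0 \<le> n * \<tau>'" using \<tau>(4) by simp
    note near = robust_risk_near_empirical[where l = l and y = y,
        OF n sp f1 less_imp_le[OF \<open>0 < \<rho>\<close>] \<kappa> L.measurable_loss[OF y] lb Zb b]
    show "ereal ((\<integral>s. l y s \<partial>S) - e)
        \<le> robust_risk f (\<rho> / n) (empirical_measure S n (\<lambda>i. \<xi> i \<omega>)) l y \<and>
      robust_risk f (\<rho> / n) (empirical_measure S n (\<lambda>i. \<xi> i \<omega>)) l y \<le> ereal ((\<integral>s. l y s \<partial>S) + e)"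
      using order_trans[OF _ near(1)] order_trans[OF near(2)] le ge unfolding m_def by simp
  qed
qed

section \<open>Outer probability, norm comparison and the final argument\<close>

text \<open>The exceedance sets may fail to be measurable, but each is contained in an event of
  vanishing probability, and outer measure is monotone. The index 0, where there is no sample, does
  not affect the limit.\<close>

lemma (in prob_space) tendsto_zero_outer_probI:
  assumes "\<And>e::real. e > 0 \<Longrightarrow> \<exists>B. (\<forall>n. B n \<in> events) \<and> (\<lambda>n. prob (B n)) \<longlonglongrightarrow> 0 \<and>
    (\<forall>n>0. \<forall>\<omega>\<in>space M - B n. \<bar>Y n \<omega>\<bar> \<le> ereal e)"
  shows "tendsto_zero_outer_prob M Y"
  unfolding tendsto_zero_outer_prob_def
proof (intro allI impI)
  fix e :: real assume "e > 0"
  from assms[OF this] obtain B where B: "\<forall>n. B n \<in> events" "(\<lambda>n. prob (B n)) \<longlonglongrightarrow> 0"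
    "\<forall>n>0. \<forall>\<omega>\<in>space M - B n. \<bar>Y n \<omega>\<bar> \<le> ereal e" by (elim exE conjE)
  have le: "outer_measure_of M {\<omega> \<in> space M. \<bar>Y n \<omega>\<bar> > ereal e} \<le> ennreal (prob (B n))" if "n > 0" for n
  proof -
    have "{\<omega> \<in> space M. \<bar>Y n \<omega>\<bar> > ereal e} \<subseteq> B n" using B(3) that not_le by blast
    then show ?thesis
      using outer_measure_of_mono[of _ "B n" M] B(1) by (simp add: emeasure_eq_measure)
  qed
  have lim: "(\<lambda>n. ennreal (prob (B n))) \<longlonglongrightarrow> 0"
    using tendsto_ennrealI[OF B(2)] by simp
  have "\<forall>\<^sub>F n in sequentially. outer_measure_of M {\<omega> \<in> space M. \<bar>Y n \<omega>\<bar> > ereal e} \<le> ennreal (prob (B n))"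
    using eventually_gt_at_top[of 0] by eventually_elim (rule le)
  from tendsto_sandwich[OF _ this tendsto_const lim]
  show "(\<lambda>n. outer_measure_of M {\<omega> \<in> space M. \<bar>Y n \<omega>\<bar> > ereal e}) \<longlonglongrightarrow> 0" by simp
qed

text \<open>Expand \<open>x\<close> in the orthonormal basis and use the triangle inequality with
  \<open>\<bar>x \<bullet> b\<bar> \<le> norm x\<close>. The 1 added to the sum over
  \<open>Basis\<close> makes positivity of the constant immediate.\<close>

lemma is_norm_le_norm:
  fixes N :: "'a::euclidean_space \<Rightarrow> real"
  assumes "is_norm N"
  obtains C where "C > 0" "\<And>x. N x \<le> C * norm x"
proof
  have sub: "N (sum g A) \<le> (\<Sum>a\<in>A. N (g a))" if "finite A" for g :: "'a \<Rightarrow> 'a" and A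
    using that
  proof (induction A rule: finite_induct)
    case empty
    have "N 0 = 0" using assms unfolding is_norm_def by blast
    then show ?case by simp
  next
    case (insert a A)
    have "N (g a + sum g A) \<le> N (g a) + N (sum g A)" using assms by (simp add: is_norm_def)
    with insert show ?case by simp
  qed
  show "1 + sum N Basis > 0"
    using assms by (intro add_pos_nonneg sum_nonneg) (auto simp: is_norm_def)
  fix x :: 'a
  have "N x = N (\<Sum>b\<in>Basis. (x \<bullet> b) *\<^sub>R b)" by (simp add: euclidean_representation)
  also have "\<dots> \<le> (\<Sum>b\<in>Basis. N ((x \<bullet> b) *\<^sub>R b))" by (rule sub) simp
  also have "\<dots> = (\<Sum>b\<in>Basis. \<bar>x \<bullet> b\<bar> * N b)" using assms by (simp add: is_norm_def)
  also have "\<dots> \<le> (\<Sum>b\<in>Basis. norm x * N b)"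
    using assms by (intro sum_mono mult_right_mono) (auto simp: is_norm_def Basis_le_norm)
  also have "\<dots> \<le> (1 + sum N Basis) * norm x"
    by (simp add: sum_distrib_left algebra_simps)
  finally show "N x \<le> (1 + sum N Basis) * norm x" .
qed

text \<open>The attained minimum makes the infimum of \<open>R\<close> a real number, and the
  two-sided bound then confines the infimum of \<open>h\<close> to finite values, so the
  extended-real difference is an ordinary one.\<close>

lemma abs_INF_diff_le:
  fixes R :: "'a \<Rightarrow> real" and h :: "'a \<Rightarrow> ereal"
  assumes m: "m \<in> X" "\<And>y. y \<in> X \<Longrightarrow> R m \<le> R y"
    and h: "\<And>y. y \<in> X \<Longrightarrow> ereal (R y - e) \<le> h y \<and> h y \<le> ereal (R y + e)"
  shows "\<bar>(INF y\<in>X. h y) - (INF y\<in>X. ereal (R y))\<bar> \<le> ereal e"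
proof -
  have R: "(INF y\<in>X. ereal (R y)) = ereal (R m)"
    using m by (intro antisym INF_lower2[of m] INF_greatest) auto
  have "(INF y\<in>X. h y) \<le> ereal (R m + e)" using m h by (intro INF_lower2[of m]) auto
  moreover have "ereal (R m - e) \<le> (INF y\<in>X. h y)"
  proof (rule INF_greatest)
    fix y assume y: "y \<in> X"
    have "ereal (R m - e) \<le> ereal (R y - e)" using m(2)[OF y] by simp
    with h[OF y] show "ereal (R m - e) \<le> h y" by (blast intro: order_trans)
  qed
  ultimately show ?thesis
    unfolding R by (cases "INF y\<in>X. h y") auto
qed

theorem corollary1:
  fixes M :: "'w measure"
    and P0 :: "'b::{metric_space, second_countable_topology} measure"
    and X :: "(real ^ 'd) set"
    and l :: "real ^ 'd \<Rightarrow> 'b \<Rightarrow> real"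
    and \<xi> :: "nat \<Rightarrow> 'w \<Rightarrow> 'b"
    and f :: "real \<Rightarrow> ereal"
    and Z :: "'b \<Rightarrow> real"
    and N :: "real ^ 'd \<Rightarrow> real"
    and \<rho> \<epsilon> :: real
  assumes "prob_space M" and "prob_space P0"
    and "is_norm N"
    and "X \<noteq> {}" and "compact X"
    and "\<And>x. x \<in> X \<Longrightarrow> l x \<in> borel_measurable P0"
    and "\<And>s. s \<in> space P0 \<Longrightarrow> continuous_on X (\<lambda>x. l x s)"
    and "prob_space.indep_vars M (\<lambda>_. P0) \<xi> {1..}"
    and "\<And>i. i \<ge> 1 \<Longrightarrow> distr M P0 (\<xi> i) = P0"
    and "smooth_divergence_generator f"
    and "\<rho> > 0" and "\<epsilon> > 0"
    and "\<And>s. s \<in> space P0 \<Longrightarrow> 0 \<le> Z s"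
    and "\<And>x s. x \<in> X \<Longrightarrow> s \<in> space P0 \<Longrightarrow> \<bar>l x s\<bar> \<le> Z s"
    and "integrable P0 (\<lambda>s. Z s powr (1 + \<epsilon>))"
  defines "P_hat \<equiv> \<lambda>n \<omega>. empirical_measure P0 n (\<lambda>i. \<xi> i \<omega>)"
  shows "tendsto_zero_outer_prob M
           (\<lambda>n \<omega>. (INF x\<in>X. robust_risk f (\<rho> / real n) (P_hat n \<omega>) l x) - (INF x\<in>X. risk P0 l x)) \<and>
         tendsto_zero_outer_prob M
           (\<lambda>n \<omega>. excess_dist N
              (argmin_on X (robust_risk f (\<rho> / real n) (P_hat n \<omega>) l))
              (argmin_on X (risk P0 l)))"
proof -
  interpret prob_space M by fact
  interpret P0: prob_space P0 by fact
  interpret iid_sample M P0 \<xi> using assms(8,9) by unfold_locales auto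
  have int_Z: "integrable P0 Z"
    by (rule integrable_if_powr_integrable[OF P0.finite_measure_axioms assms(13,12,15)])
  have loss: "dominated_loss P0 X l Z"
    using assms(5-7,14) int_Z by unfold_locales auto
  interpret L: dominated_loss P0 X l Z by (rule loss)
  define R where "R = (\<lambda>x. \<integral>s. l x s \<partial>P0)"
  define h where "h = (\<lambda>n \<omega>. robust_risk f (\<rho> / real n) (P_hat n \<omega>) l)"
  have risk: "risk P0 l = (\<lambda>x. ereal (R x))" by (auto simp: risk_def R_def)
  have R: "continuous_on X R" unfolding R_def by (rule L.continuous_expected_loss)
  obtain m where m: "m \<in> X" "\<And>y. y \<in> X \<Longrightarrow> R m \<le> R y"
    using continuous_attains_inf[OF assms(5,4) R] by blast
  have near: "\<exists>B. (\<forall>n. B n \<in> events) \<and> (\<lambda>n. prob (B n)) \<longlonglongrightarrow> 0 \<and> (\<forall>n>0. \<forall>\<omega>\<in>space M - B n.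
      \<forall>y\<in>X. ereal (R y - e) \<le> h n \<omega> y \<and> h n \<omega> y \<le> ereal (R y + e))" if e: "e > 0" for e :: real
    unfolding h_def P_hat_def R_def
    by (rule robust_risk_uniform_convergence[OF loss assms(10-13,15) e]) blast+
  have "tendsto_zero_outer_prob M (\<lambda>n \<omega>. (INF x\<in>X. h n \<omega> x) - (INF x\<in>X. risk P0 l x))"
    unfolding risk
  proof (rule tendsto_zero_outer_probI)
    fix e :: real assume "e > 0"
    then obtain B where B: "\<forall>n. B n \<in> events" "(\<lambda>n. prob (B n)) \<longlonglongrightarrow> 0"
      "\<forall>n>0. \<forall>\<omega>\<in>space M - B n. \<forall>y\<in>X. ereal (R y - e) \<le> h n \<omega> y \<and> h n \<omega> y \<le> ereal (R y + e)"
      using near by blast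
    have "\<bar>(INF x\<in>X. h n \<omega> x) - (INF x\<in>X. ereal (R x))\<bar> \<le> ereal e"
      if "n > 0" "\<omega> \<in> space M - B n" for n \<omega>
      using that B(3) by (intro abs_INF_diff_le[where m = m] m) auto
    with B show "\<exists>B. (\<forall>n. B n \<in> events) \<and> (\<lambda>n. prob (B n)) \<longlonglongrightarrow> 0 \<and> (\<forall>n>0. \<forall>\<omega>\<in>space M - B n.
        \<bar>(INF x\<in>X. h n \<omega> x) - (INF x\<in>X. ereal (R x))\<bar> \<le> ereal e)"
      by blast
  qed
  moreover have "tendsto_zero_outer_prob M
      (\<lambda>n \<omega>. excess_dist N (argmin_on X (h n \<omega>)) (argmin_on X (risk P0 l)))"
    unfolding risk
  proof (rule tendsto_zero_outer_probI)
    fix e :: real assume e: "e > 0"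
    obtain C where C: "C > 0" "\<And>x. N x \<le> C * norm x" by (rule is_norm_le_norm[OF assms(3)]) blast
    have N0: "0 \<le> N x" for x using assms(3) by (simp add: is_norm_def)
    \<comment> \<open>Euclidean distance below \<open>e / C\<close> turns into
      \<open>N\<close>-distance at most \<open>e\<close>.\<close>
    have "0 < e / C" using e C by simp
    then obtain a where a: "a > 0" "\<And>x. x \<in> X \<Longrightarrow> (\<And>y. y \<in> X \<Longrightarrow> R x \<le> R y + a) \<Longrightarrow>
        \<exists>y. y \<in> argmin_on X (\<lambda>x. ereal (R x)) \<and> dist x y < e / C"
      by (rule argmin_stability[OF assms(5,4) R]) blast
    \<comment> \<open>Uniform closeness within \<open>a / 2\<close> makes a robust minimiser an
      \<open>a\<close>-minimiser of \<open>R\<close>, since the error is incurred once at the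
      minimiser and once at its competitor.\<close>
    obtain B where B: "\<forall>n. B n \<in> events" "(\<lambda>n. prob (B n)) \<longlonglongrightarrow> 0"
      "\<forall>n>0. \<forall>\<omega>\<in>space M - B n. \<forall>y\<in>X.
        ereal (R y - a / 2) \<le> h n \<omega> y \<and> h n \<omega> y \<le> ereal (R y + a / 2)"
      using near[of "a / 2"] a(1) by auto
    have "\<bar>excess_dist N (argmin_on X (h n \<omega>)) (argmin_on X (\<lambda>x. ereal (R x)))\<bar> \<le> ereal e"
      if n: "n > 0" and \<omega>: "\<omega> \<in> space M - B n" for n \<omega>
    proof -
      let ?A = "argmin_on X (\<lambda>x. ereal (R x))"
      have le: "(INF y\<in>?A. ereal (N (x - y))) \<le> ereal e" if x: "x \<in> argmin_on X (h n \<omega>)" for x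
      proof -
        have xX: "x \<in> X" and min: "\<And>y. y \<in> X \<Longrightarrow> h n \<omega> x \<le> h n \<omega> y"
          using x by (auto simp: argmin_on_def is_arg_min_def not_less)
        have "R x \<le> R y + a" if y: "y \<in> X" for y
        proof -
          have "ereal (R x - a / 2) \<le> h n \<omega> x" using B(3) n \<omega> xX by blast
          also have "\<dots> \<le> h n \<omega> y" by (rule min[OF y])
          also have "\<dots> \<le> ereal (R y + a / 2)" using B(3) n \<omega> y by blast
          finally show ?thesis by simp
        qed
        then obtain y where y: "y \<in> ?A" "dist x y < e / C" using a(2)[OF xX] by blast
        have "N (x - y) \<le> C * norm (x - y)" by (rule C(2))
        also have "\<dots> \<le> e" using y(2) C(1) by (simp add: dist_norm field_simps)
        finally show ?thesis using y(1) by (intro INF_lower2[of y]) auto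
      qed
      \<comment> \<open>The minorant with zone radius 1 serves here to give
        \<open>f \<ge> 0\<close>, from which existence of robust minimisers follows.\<close>
      obtain \<kappa> where \<kappa>: "\<kappa> > 0" "\<And>t. 0 \<le> t \<Longrightarrow> ereal (\<kappa> * max 0 (\<bar>t - 1\<bar> - 1)) \<le> f t"
        by (rule divergence_generator_minorant[OF assms(10) zero_less_one]) blast
      have "0 \<le> f t" if "0 \<le> t" for t
        using \<kappa>(1) by (intro order_trans[OF _ \<kappa>(2)[OF that]]) simp
      then have "argmin_on X (h n \<omega>) \<noteq> {}"
        unfolding h_def P_hat_def using \<omega> n sample_in_space assms(4-7)
        by (intro argmin_robust_risk_empirical_nonempty) auto
      then obtain x where x: "x \<in> argmin_on X (h n \<omega>)" by blast
      have "0 \<le> excess_dist N (argmin_on X (h n \<omega>)) ?A"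
        unfolding excess_dist_def using N0 by (intro SUP_upper2[OF x] INF_greatest) auto
      moreover have "excess_dist N (argmin_on X (h n \<omega>)) ?A \<le> ereal e"
        unfolding excess_dist_def by (intro SUP_least le)
      ultimately show ?thesis by simp
    qed
    with B show "\<exists>B. (\<forall>n. B n \<in> events) \<and> (\<lambda>n. prob (B n)) \<longlonglongrightarrow> 0 \<and> (\<forall>n>0. \<forall>\<omega>\<in>space M - B n.
        \<bar>excess_dist N (argmin_on X (h n \<omega>)) (argmin_on X (\<lambda>x. ereal (R x)))\<bar> \<le> ereal e)"
      by blast
  qed
  ultimately show ?thesis unfolding h_def by blast
qed

end
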